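(* For $n\ge0$ and $q=e^{2\pi i\tau}$, $\tau=u+iv\in\mathbb{H}$, let \[U_{2n}(q):=\frac{\sum_{m\ge0}(-1)^m(2m+1)^{2n+1}q^{\frac{m(m+1)}2}}{\sum_{m\ge0}(-1)^m(2m+1)q^{\frac{m(m+1)}2}},\qquad V_{2n}(q):=\frac{\sum_{m\in\mathbb{Z}}(-1)^m(6m+1)^{2n}q^{\frac{m(3m+1)}2}}{\sum_{m\in\mathbb{Z}}(-1)^mq^{\frac{m(3m+1)}2}},\] and define \[\widehat U_{2n}(\tau):=2i\sum_{0\le j\le n}(-1)^{n+j}\frac{\pi^{2n-j+1}U_{2n-2j}(q)}{(2v)^jj!(2n-2j+1)!},\qquad \widehat V_{2n}(\tau):=\sum_{0\le j\le n}(-1)^{n+j}\frac{3^j\pi^{2n-j}V_{2n-2j}(q)}{(2v)^jj!(2n-2j)!}.\] Then: (1) $\widehat U_{2n}$ and $\widehat V_{2n}$ are almost holomorphic modular forms of weight $2n$ and depth $n$. (2) $\widehat U_0=2\pi i$, $\widehat V_0=1$, and for $n\ge1$, $L(\widehat U_{2n})=-\frac{\pi}{2}\widehat U_{2n-2}$ and $L(\widehat V_{2n})=-\frac{3\pi}{2}\widehat V_{2n-2}$, where $L:=-2iv^2\frac{\partial}{\partial\overline\tau}$. (3) $\lim_{\overline\tau\to-i\infty}\widehat U_{2n}(\tau)=\frac{2(\pi i)^{2n+1}U_{2n}(q)}{(2n+1)!}$ and $\lim_{\overline\tau\to-i\infty}\widehat V_{2n}(\tau)=\frac{(\pi i)^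{2n}}{(2n)!}V_{2n}(q)$.
   Context: An almost holomorphic modular form of weight $k$ is a function $f$ on $\mathbb{H}$ satisfying $f\big(\frac{a\tau+b}{c\tau+d}\big)=(c\tau+d)^kf(\tau)$ for all $\begin{psmallmatrix}a&b\\c&d\end{psmallmatrix}\in\mathrm{SL}_2(\mathbb{Z})$ that is a polynomial in $\frac1v$ with holomorphic coefficients; the degree of this polynomial is the depth. For $f=\sum_jf_j(\tau)v^{-j}$ such a polynomial, $\lim_{\overline\tau\to-i\infty}f(\tau):=f_0(\tau)$ (treating $\tau$ and $\overline\tau$ as independent variables). *)

theory Defs
  imports "HOL-Complex_Analysis.Complex_Analysis"
begin

definition upper_half_plane :: "complex set" where
  "upper_half_plane = {\<tau>. Im \<tau> > 0}"

definition to_q :: "complex \<Rightarrow> complex" where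
  "to_q \<tau> = exp (2 * of_real pi * \<i> * \<tau>)"

text \<open>The index \<open>n\<close> of \<open>U\<close>, \<open>V\<close>, \<open>U_hat\<close>, \<open>V_hat\<close> below is half of the
  subscript in the usual notation: \<open>U n\<close> is \<open>U\<^sub>2\<^sub>n\<close>, and likewise for the others.\<close>

definition U :: "nat \<Rightarrow> complex \<Rightarrow> complex" where
  "U n q =
     (\<Sum>m. (-1) ^ m * of_nat (2 * m + 1) ^ (2 * n + 1) * q ^ (m * (m + 1) div 2)) /
     (\<Sum>m. (-1) ^ m * of_nat (2 * m + 1) * q ^ (m * (m + 1) div 2))"

definition V :: "nat \<Rightarrow> complex \<Rightarrow> complex" where
  "V n q =
     (\<Sum>\<^sub>\<infinity>m::int. (-1) powi m * of_int (6 * m + 1) ^ (2 * n) * q powi (m * (3 * m + 1) div 2)) /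
     (\<Sum>\<^sub>\<infinity>m::int. (-1) powi m * q powi (m * (3 * m + 1) div 2))"

definition U_hat :: "nat \<Rightarrow> complex \<Rightarrow> complex" where
  "U_hat n \<tau> = 2 * \<i> * (\<Sum>j\<le>n. (-1) ^ (n + j) *
     (of_real pi ^ (2 * n - j + 1) * U (n - j) (to_q \<tau>)) /
     ((2 * of_real (Im \<tau>)) ^ j * fact j * fact (2 * n - 2 * j + 1)))"

definition V_hat :: "nat \<Rightarrow> complex \<Rightarrow> complex" where
  "V_hat n \<tau> = (\<Sum>j\<le>n. (-1) ^ (n + j) *
     (3 ^ j * of_real pi ^ (2 * n - j) * V (n - j) (to_q \<tau>)) /
     ((2 * of_real (Im \<tau>)) ^ j * fact j * fact (2 * n - 2 * j)))"

text \<open>\<open>f\<close> is a polynomial in \<open>1/v\<close>, \<open>v = Im \<tau>\<close>, of formal degree \<open>d\<close> with holomorphic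
  coefficients \<open>g 0, \<dots>, g d\<close>; the coefficients are uniquely determined by \<open>f\<close> on the
  upper half-plane.\<close>

definition almost_holomorphic_expansion ::
    "(complex \<Rightarrow> complex) \<Rightarrow> nat \<Rightarrow> (nat \<Rightarrow> complex \<Rightarrow> complex) \<Rightarrow> bool" where
  "almost_holomorphic_expansion f d g \<longleftrightarrow>
     (\<forall>j\<le>d. g j holomorphic_on upper_half_plane) \<and>
     (\<forall>\<tau>\<in>upper_half_plane. f \<tau> = (\<Sum>j\<le>d. g j \<tau> * (1 / of_real (Im \<tau>)) ^ j))"

definition almost_holomorphic_modular_form :: "int \<Rightarrow> (complex \<Rightarrow> complex) \<Rightarrow> bool" where
  "almost_holomorphic_modular_form k f \<longleftrightarrow>
     (\<forall>a b c d :: int. a * d - b * c = 1 \<longrightarrow>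
        (\<forall>\<tau>\<in>upper_half_plane.
           f ((of_int a * \<tau> + of_int b) / (of_int c * \<tau> + of_int d)) =
             (of_int c * \<tau> + of_int d) powi k * f \<tau>)) \<and>
     (\<exists>d g. almost_holomorphic_expansion f d g)"

definition depth :: "(complex \<Rightarrow> complex) \<Rightarrow> nat" where
  "depth f = (THE d. \<exists>g. almost_holomorphic_expansion f d g \<and>
                         (\<exists>\<tau>\<in>upper_half_plane. g d \<tau> \<noteq> 0))"

text \<open>The limit as the conjugate variable tends to \<open>-\<i>\<infinity>\<close>: the constant coefficient of the
  expansion in \<open>1/v\<close>.\<close>

definition conj_limit :: "(complex \<Rightarrow> complex) \<Rightarrow> complex \<Rightarrow> complex" where
  "conj_limit f \<tau> = (THE w. \<exists>d g. almost_holomorphic_expansion f d g \<and> w = g 0 \<tau>)"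

text \<open>The Wirtinger derivative with respect to the conjugate variable,
  \<open>(\<partial>/\<partial>u + \<i> \<partial>/\<partial>v) / 2\<close> for \<open>\<tau> = u + \<i> v\<close>.\<close>

definition deriv_conj :: "(complex \<Rightarrow> complex) \<Rightarrow> complex \<Rightarrow> complex" where
  "deriv_conj f \<tau> =
     (vector_derivative (\<lambda>u. f (Complex u (Im \<tau>))) (at (Re \<tau>)) +
      \<i> * vector_derivative (\<lambda>v. f (Complex (Re \<tau>) v)) (at (Im \<tau>))) / 2"

definition lowering_op :: "(complex \<Rightarrow> complex) \<Rightarrow> complex \<Rightarrow> complex" where
  "lowering_op f \<tau> = - 2 * \<i> * of_real (Im \<tau>) ^ 2 * deriv_conj f \<tau>"

end

theory Submission
  imports Defs
begin

text \<open>
  For \<open>K = 1, 3\<close> let \<open>\<theta>\<^sub>K(z) = \<Sum>\<^sub>m (-1)\<^sup>m q\<^bsup>m(Km+1)/2\<^esup> exp (\<pi>i(2Km+1)z)\<close>, summed over the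
  integers. Up to a factor independent of \<open>z\<close>, \<open>U_hat n\<close> is the coefficient of \<open>z\<^bsup>2n+1\<^esup>\<close> in
  \<open>exp (\<pi>z\<^sup>2/2v) \<theta>\<^sub>1(z)\<close>, and \<open>V_hat n\<close> is the coefficient of \<open>z\<^bsup>2n\<^esup>\<close> in
  \<open>exp (3\<pi>z\<^sup>2/2v) (\<theta>\<^sub>3(z) + \<theta>\<^sub>3(-z))\<close>. So modularity follows from the transformation of
  these two functions under \<open>(\<tau>, z) \<mapsto> ((a\<tau>+b)/(c\<tau>+d), z/(c\<tau>+d))\<close>, and it is enough to know it up
  to an unspecified factor independent of \<open>z\<close>, which the leading coefficient determines.

  By Liouville's theorem an entire function that vanishes on the lattice \<open>\<int>\<tau> + \<int>\<close> and has the
  quasi-periods of \<open>\<theta>\<^sub>1\<close> with respect to \<open>2\<close> and \<open>2\<tau>\<close> is a multiple of an explicit product \<open>P\<close>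
  with simple zeros on the lattice. This applies to \<open>\<theta>\<^sub>1(z)\<close> itself, to its transform under an
  arbitrary element of \<open>SL\<^sub>2(\<int>)\<close> (no generators are needed), and, since \<open>\<theta>\<^sub>3(z) + \<theta>\<^sub>3(-z)\<close>
  vanishes at the half periods outside the lattice, to \<open>(\<theta>\<^sub>3(z) + \<theta>\<^sub>3(-z)) P(z)\<close> as a function
  of \<open>2z\<close>. The multiples are nonzero because some Fourier coefficient is, and so the denominators
  of \<open>U\<close> and \<open>V\<close> have no zeros.

  Uniqueness of the expansion in \<open>1/v\<close> follows by applying the lowering operator repeatedly.
\<close>

subsection \<open>Entire functions\<close>

text \<open>A simple zero of \<open>P\<close> is cancelled by any zero of \<open>f\<close> at the
  same point, so the quotient has only removable singularities.\<close>

lemma entire_div_simple_zeros: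
  fixes f P :: "complex \<Rightarrow> complex"
  assumes f: "f holomorphic_on UNIV" and P: "P holomorphic_on UNIV"
    and zeros: "\<And>z. P z = 0 \<Longrightarrow> f z = 0" and simple: "\<And>z. P z = 0 \<Longrightarrow> deriv P z \<noteq> 0"
  obtains h where "h holomorphic_on UNIV" "\<And>z. f z = P z * h z"
proof
  define h where "h z = (if P z = 0 then deriv f z / deriv P z else f z / P z)" for z
  show "f z = P z * h z" for z
    using zeros by (simp add: h_def)
  have cont: "continuous_on UNIV P"
    using P by (rule holomorphic_on_imp_continuous_on)
  have "\<exists>S. open S \<and> w \<in> S \<and> h holomorphic_on S" for w
  proof (cases "P w = 0")
    case False
    let ?S = "{z. P z \<noteq> 0}"
    have "open ?S"
      by (rule open_Collect_neq) (auto intro: cont)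
    moreover have "(\<lambda>z. f z / P z) holomorphic_on ?S"
      by (intro holomorphic_intros holomorphic_on_subset[OF f] holomorphic_on_subset[OF P]) auto
    then have "h holomorphic_on ?S"
      by (rule holomorphic_transform) (simp add: h_def)
    ultimately show ?thesis
      using False by blast
  next
    case True
    \<comment> \<open>The difference quotients \<open>F\<close> and \<open>G\<close> at
      \<open>w\<close> are entire, and \<open>G w\<close> is nonzero because the zero is simple.
      Where \<open>G\<close> does not vanish, \<open>F / G\<close> agrees with
      \<open>h\<close>.\<close>
    define F where "F z = (if z = w then deriv f w else (f z - f w) / (z - w))" for z
    define G where "G z = (if z = w then deriv P w else (P z - P w) / (z - w))" for z
    have F: "F holomorphic_on UNIV" and G: "G holomorphic_on UNIV"
      using pole_lemma_open[OF f, of w] pole_lemma_open[OF P, of w]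
      by (simp_all add: F_def[abs_def] G_def[abs_def])
    let ?S = "{z. G z \<noteq> 0}"
    have "open ?S"
      by (rule open_Collect_neq) (auto intro: holomorphic_on_imp_continuous_on G)
    moreover have "w \<in> ?S"
      using simple[OF True] by (simp add: G_def)
    moreover have "(\<lambda>z. F z / G z) holomorphic_on ?S"
      by (intro holomorphic_intros holomorphic_on_subset[OF F] holomorphic_on_subset[OF G]) auto
    then have "h holomorphic_on ?S"
    proof (rule holomorphic_transform)
      fix z assume "z \<in> ?S"
      then show "F z / G z = h z"
        using True zeros[OF True] by (auto simp: F_def G_def h_def split: if_splits)
    qed
    ultimately show ?thesis
      by blast
  qed
  then show "h holomorphic_on UNIV"
    by (metis UNIV_I field_differentiable_at_within holomorphic_on_def
        holomorphic_on_imp_differentiable_at)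
qed

text \<open>This cancels \<open>P\<close> from an identity without excluding its zeros: at a zero of
  \<open>P\<close> the derivative of \<open>P * D\<close> is \<open>deriv P z * D z\<close>.\<close>

lemma eq_0_if_mult_simple_zeros_eq_0:
  fixes D P :: "complex \<Rightarrow> complex"
  assumes D: "D holomorphic_on UNIV" and P: "P holomorphic_on UNIV"
    and simple: "\<And>z. P z = 0 \<Longrightarrow> deriv P z \<noteq> 0" and PD: "\<And>z. P z * D z = 0"
  shows "D z = 0"
proof (cases "P z = 0")
  case True
  have "((\<lambda>z. P z * D z) has_field_derivative P z * deriv D z + deriv P z * D z) (at z)"
    using holomorphic_derivI[OF P open_UNIV UNIV_I[of z]] holomorphic_derivI[OF D open_UNIV UNIV_I[of z]]
    by (auto intro!: derivative_eq_intros)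
  moreover have "((\<lambda>z. P z * D z) has_field_derivative 0) (at z)"
    by (simp add: PD)
  ultimately have "P z * deriv D z + deriv P z * D z = 0"
    by (rule DERIV_unique)
  with True simple show ?thesis
    by auto
qed (use PD[of z] in auto)

text \<open>The value type is arbitrary, so that periodic predicates are covered as well as periodic
  functions.\<close>

lemma periodic_of_int:
  fixes h :: "complex \<Rightarrow> 'a"
  assumes "\<And>z. h (z + a) = h z"
  shows "h (z + of_int m * a) = h z"
proof (induction m rule: int_induct[where k = 0])
  case (step1 i)
  then show ?case
    using assms[of "z + of_int i * a"] by (simp add: algebra_simps)
next
  case (step2 i)
  then show ?case
    using assms[of "z + of_int (i - 1) * a"] by (simp add: algebra_simps)
qed simp

text \<open>All values are already taken on a closed period parallelogram, which is compact, and
  Liouville's theorem applies.\<close>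

lemma doubly_periodic_entire_constant:
  fixes h :: "complex \<Rightarrow> complex"
  assumes h: "h holomorphic_on UNIV" and ab: "a \<noteq> 0" "Im (b / a) \<noteq> 0"
    and pa: "\<And>z. h (z + a) = h z" and pb: "\<And>z. h (z + b) = h z"
  obtains c where "\<And>z. h z = c"
proof -
  let ?Q = "(\<lambda>(s, t). of_real s * a + of_real t * b) ` ({0..1} \<times> {0..1::real})"
  have "compact ?Q"
    by (intro compact_continuous_image)
       (auto intro!: continuous_intros compact_Times simp: case_prod_unfold)
  then have "compact (h ` ?Q)"
    by (rule compact_continuous_image[rotated])
       (intro holomorphic_on_imp_continuous_on holomorphic_on_subset[OF h] subset_UNIV)
  moreover have "range h \<subseteq> h ` ?Q"
  proof safe
    fix z
    define r where "r = b / a"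
    define y where "y = z / a"
    \<comment> \<open>The real coordinates \<open>s\<close> and \<open>t\<close> of \<open>z\<close>
      in the basis \<open>a\<close>, \<open>b\<close> are read off from y = s + t r. Their
      fractional parts give the representative in the parallelogram.\<close>
    define t where "t = Im y / Im r"
    define s where "s = Re y - t * Re r"
    have "Im r \<noteq> 0"
      using ab by (simp add: r_def)
    then have "y = of_real s + of_real t * r"
      by (intro complex_eqI) (simp_all add: s_def t_def)
    then have z: "z = of_real s * a + of_real t * b"
      using ab(1) by (simp add: field_simps r_def y_def)
    let ?w = "of_real (frac s) * a + of_real (frac t) * b"
    have "z = ?w + of_int \<lfloor>s\<rfloor> * a + of_int \<lfloor>t\<rfloor> * b"
      by (subst z) (simp add: frac_def algebra_simps)
    then have "h z = h ?w"
      using periodic_of_int[of h a, OF pa] periodic_of_int[of h b, OF pb] by metis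
    moreover have "?w \<in> ?Q"
      by (rule image_eqI[of _ _ "(frac s, frac t)"]) (auto simp: frac_ge_0 less_imp_le[OF frac_lt_1])
    ultimately show "h z \<in> h ` ?Q"
      by auto
  qed
  ultimately have "bounded (range h)"
    using bounded_subset compact_imp_bounded by blast
  then have "h constant_on UNIV"
    by (rule Liouville_theorem[OF h])
  then show ?thesis
    using that by (auto simp: constant_on_def)
qed

subsection \<open>Expansions in the reciprocal of the imaginary part\<close>

lemma has_vector_derivative_horizontal:
  assumes "(g has_field_derivative g') (at \<tau>)"
  shows "((\<lambda>x. g (Complex x (Im \<tau>))) has_vector_derivative g') (at (Re \<tau>))"
proof -
  have "((\<lambda>x. of_real x + \<i> * of_real (Im \<tau>)) has_vector_derivative 1) (at (Re \<tau>))"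
    by (auto intro!: derivative_eq_intros)
  from field_vector_diff_chain_at[OF this] show ?thesis
    using assms by (simp add: o_def Complex_eq[symmetric])
qed

lemma has_vector_derivative_vertical:
  assumes "(g has_field_derivative g') (at \<tau>)"
  shows "((\<lambda>y. g (Complex (Re \<tau>) y)) has_vector_derivative \<i> * g') (at (Im \<tau>))"
proof -
  have "((\<lambda>y. of_real (Re \<tau>) + \<i> * of_real y) has_vector_derivative \<i>) (at (Im \<tau>))"
    by (auto intro!: derivative_eq_intros)
  from field_vector_diff_chain_at[OF this] show ?thesis
    using assms by (simp add: o_def Complex_eq[symmetric])
qed

lemma open_upper_half_plane: "open upper_half_plane"
  unfolding upper_half_plane_def by (rule open_halfspace_Im_gt)

text \<open>The conjugate derivative kills the holomorphic coefficients and sees only the powers of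
  1/v, and the factor v^2 lowers the resulting exponent j + 1 to j - 1. For j = 0 the truncated
  exponent is harmless, since the term has the factor 0.\<close>

lemma lowering_op_expansion:
  assumes f: "almost_holomorphic_expansion f d g" and \<tau>: "\<tau> \<in> upper_half_plane"
  shows "lowering_op f \<tau> = - (\<Sum>j\<le>d. of_nat j * g j \<tau> * (1 / of_real (Im \<tau>)) ^ (j - 1))"
proof -
  define v where "v = Im \<tau>"
  have v: "v > 0"
    using \<tau> by (simp add: v_def upper_half_plane_def)
  have f_eq: "f (Complex x y) = (\<Sum>j\<le>d. g j (Complex x y) * of_real ((1 / y) ^ j))" if "y > 0" for x y
    using f that by (simp add: almost_holomorphic_expansion_def upper_half_plane_def)
  have g: "(g j has_field_derivative deriv (g j) \<tau>) (at \<tau>)" if "j \<le> d" for j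
    using f that \<tau> holomorphic_derivI[OF _ open_upper_half_plane]
    by (auto simp: almost_holomorphic_expansion_def)
  define A where "A = (\<Sum>j\<le>d. deriv (g j) \<tau> * of_real ((1 / v) ^ j))"
  define B where "B = (\<Sum>j\<le>d. g j \<tau> * of_real (- (real j * (1 / v) ^ (j + 1))))"
  have "((\<lambda>x. f (Complex x v)) has_vector_derivative A) (at (Re \<tau>))"
    unfolding f_eq[OF v] A_def
    unfolding v_def
    by (intro has_vector_derivative_sum has_vector_derivative_mult_left
        has_vector_derivative_horizontal g) auto
  then have 1: "vector_derivative (\<lambda>x. f (Complex x v)) (at (Re \<tau>)) = A"
    by (rule vector_derivative_at)
  have "((\<lambda>y. (1 / y) ^ j) has_vector_derivative (- (real j * (1 / v) ^ (j + 1)))) (at v)" for j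
    using v by (cases j; auto intro!: derivative_eq_intros
        simp flip: has_real_derivative_iff_has_vector_derivative simp: field_simps power2_eq_square)
       (metis Suc_pred neq0_conv power_Suc)
  then have "((\<lambda>y. of_real ((1 / y) ^ j) :: complex) has_vector_derivative
      of_real (- (real j * (1 / v) ^ (j + 1)))) (at v)" for j
    by (rule bounded_linear.has_vector_derivative[OF bounded_linear_of_real])
  then have "((\<lambda>y. \<Sum>j\<le>d. g j (Complex (Re \<tau>) y) * of_real ((1 / y) ^ j)) has_vector_derivative
      (\<Sum>j\<le>d. g j \<tau> * of_real (- (real j * (1 / v) ^ (j + 1))) +
        (\<i> * deriv (g j) \<tau>) * of_real ((1 / v) ^ j))) (at v)"
    using has_vector_derivative_vertical[OF g]
    by (auto intro!: has_vector_derivative_sum derivative_eq_intros simp: v_def)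
  moreover have "(\<Sum>j\<le>d. g j \<tau> * of_real (- (real j * (1 / v) ^ (j + 1))) +
        (\<i> * deriv (g j) \<tau>) * of_real ((1 / v) ^ j)) = B + \<i> * A"
    by (simp only: A_def B_def sum.distrib sum_distrib_left mult.assoc)
  ultimately have "((\<lambda>y. \<Sum>j\<le>d. g j (Complex (Re \<tau>) y) * of_real ((1 / y) ^ j))
      has_vector_derivative B + \<i> * A) (at v)"
    by simp
  then have "((\<lambda>y. f (Complex (Re \<tau>) y)) has_vector_derivative B + \<i> * A) (at v)"
    by (rule has_vector_derivative_transform_within_open[where S = "{0<..}"])
       (use v f_eq in auto)
  then have 2: "vector_derivative (\<lambda>y. f (Complex (Re \<tau>) y)) (at v) = B + \<i> * A"
    by (rule vector_derivative_at)
  \<comment> \<open>The horizontal derivative is A and the vertical one is B + iA, so A + i (B + iA)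
    = iB: the derivatives of the coefficients cancel.\<close>
  have "lowering_op f \<tau> = of_real v ^ 2 * B"
    by (simp add: lowering_op_def deriv_conj_def 1 2 algebra_simps flip: v_def)
  also have "\<dots> = - (\<Sum>j\<le>d. of_nat j * g j \<tau> * (1 / of_real v) ^ (j - 1))"
    unfolding B_def sum_distrib_left sum_negf[symmetric]
  proof (rule sum.cong)
    fix j
    show "of_real v ^ 2 * (g j \<tau> * of_real (- (real j * (1 / v) ^ (j + 1)))) =
        - (of_nat j * g j \<tau> * (1 / of_real v) ^ (j - 1))"
      using v by (cases j) (auto simp: field_simps power2_eq_square)
  qed auto
  finally show ?thesis
    by (simp add: v_def)
qed

text \<open>Lowering the zero function gives an expansion of 0 of degree one less, with coefficients
  (j + 1) g_{j+1}. By induction these vanish, and then only \<open>g 0\<close> is left in the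
  original expansion.\<close>

lemma almost_holomorphic_expansion_0:
  assumes "almost_holomorphic_expansion f d g" "\<And>\<tau>. \<tau> \<in> upper_half_plane \<Longrightarrow> f \<tau> = 0"
    and "\<tau> \<in> upper_half_plane" "j \<le> d"
  shows "g j \<tau> = 0"
  using assms
proof (induction d arbitrary: f g j \<tau>)
  case 0
  then show ?case
    by (auto simp: almost_holomorphic_expansion_def)
next
  case (Suc d)
  have exp0: "almost_holomorphic_expansion (\<lambda>_. 0) (Suc d) g"
    using Suc.prems(1,2) by (auto simp: almost_holomorphic_expansion_def)
  define g' where "g' j \<tau> = of_nat (Suc j) * g (Suc j) \<tau>" for j \<tau>
  have "almost_holomorphic_expansion (\<lambda>_. 0) d g'"
    unfolding almost_holomorphic_expansion_def
  proof (intro conjI ballI allI impI)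
    fix j assume "j \<le> d"
    then show "g' j holomorphic_on upper_half_plane"
      using Suc.prems(1) unfolding g'_def[abs_def] almost_holomorphic_expansion_def
      by (intro holomorphic_intros) auto
  next
    fix \<tau> assume \<tau>: "\<tau> \<in> upper_half_plane"
    have "0 = - lowering_op (\<lambda>_. 0) \<tau>"
      by (simp add: lowering_op_def deriv_conj_def)
    also have "\<dots> = (\<Sum>j\<le>d. g' j \<tau> * (1 / of_real (Im \<tau>)) ^ j)"
      unfolding lowering_op_expansion[OF exp0 \<tau>]
      by (subst sum.atMost_Suc_shift) (simp add: g'_def)
    finally show "0 = (\<Sum>j\<le>d. g' j \<tau> * (1 / of_real (Im \<tau>)) ^ j)" .
  qed
  then have "g' j \<tau> = 0" if "j \<le> d" "\<tau> \<in> upper_half_plane" for j \<tau>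
    using Suc.IH[of "\<lambda>_. 0" g' \<tau> j] that by blast
  then have pos: "g (Suc j) \<tau> = 0" if "j \<le> d" "\<tau> \<in> upper_half_plane" for j \<tau>
    using that unfolding g'_def by (metis mult_eq_0_iff of_nat_eq_0_iff nat.simps(3))
  show ?case
  proof (cases j)
    case 0
    have "(\<Sum>j\<le>Suc d. g j \<tau> * (1 / of_real (Im \<tau>)) ^ j) = g 0 \<tau>"
      using pos Suc.prems(3) by (subst sum.atMost_Suc_shift) simp
    with exp0 Suc.prems(3) 0 show ?thesis
      by (auto simp: almost_holomorphic_expansion_def)
  qed (use pos Suc.prems in auto)
qed

lemma almost_holomorphic_expansion_pad:
  assumes "almost_holomorphic_expansion f d g" "d \<le> d'"
  shows "almost_holomorphic_expansion f d' (\<lambda>j. if j \<le> d then g j else (\<lambda>_. 0))"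
proof -
  have "(\<Sum>j\<le>d'. (if j \<le> d then g j else (\<lambda>_. 0)) \<tau> * (1 / of_real (Im \<tau>)) ^ j) =
      (\<Sum>j\<le>d. g j \<tau> * (1 / of_real (Im \<tau>)) ^ j)" for \<tau>
    using assms(2) by (intro sum.mono_neutral_cong_right) auto
  then show ?thesis
    using assms(1) by (auto simp: almost_holomorphic_expansion_def)
qed

text \<open>Coefficients beyond the formal degree count as 0, so that expansions of different formal
  degrees can be compared. After padding to a common degree, their difference is an expansion of
  0.\<close>

lemma almost_holomorphic_expansion_unique:
  assumes 1: "almost_holomorphic_expansion f d g" and 2: "almost_holomorphic_expansion f d' g'"
    and \<tau>: "\<tau> \<in> upper_half_plane"
  shows "(if j \<le> d then g j \<tau> else 0) = (if j \<le> d' then g' j \<tau> else 0)"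
proof -
  let ?D = "max j (max d d')"
  define G where "G = (\<lambda>j. if j \<le> d then g j else (\<lambda>_. 0))"
  define G' where "G' = (\<lambda>j. if j \<le> d' then g' j else (\<lambda>_. 0))"
  have "almost_holomorphic_expansion f ?D G" "almost_holomorphic_expansion f ?D G'"
    unfolding G_def G'_def by (intro almost_holomorphic_expansion_pad 1 2; simp)+
  then have "almost_holomorphic_expansion (\<lambda>_. 0) ?D (\<lambda>j \<tau>. G j \<tau> - G' j \<tau>)"
    unfolding almost_holomorphic_expansion_def
    by (auto intro!: holomorphic_on_diff simp: left_diff_distrib sum_subtractf)
  from almost_holomorphic_expansion_0[OF this _ \<tau>, of j] show ?thesis
    by (auto simp: G_def G'_def split: if_splits)
qed

text \<open>Uniqueness of the coefficients justifies the definite description in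
  \<open>depth\<close>: two top coefficients that are not identically zero must have the same
  index.\<close>

lemma depth_eqI:
  assumes f: "almost_holomorphic_expansion f d g" and nz: "\<tau> \<in> upper_half_plane" "g d \<tau> \<noteq> 0"
  shows "depth f = d"
  unfolding depth_def
proof (rule the_equality)
  fix d' assume "\<exists>g. almost_holomorphic_expansion f d' g \<and> (\<exists>\<tau>\<in>upper_half_plane. g d' \<tau> \<noteq> 0)"
  then obtain g' \<tau>' where *: "almost_holomorphic_expansion f d' g'" "\<tau>' \<in> upper_half_plane" "g' d' \<tau>' \<noteq> 0"
    by blast
  show "d' = d"
    using almost_holomorphic_expansion_unique[OF f *(1) nz(1), of d]
      almost_holomorphic_expansion_unique[OF f *(1,2), of d'] nz(2) *(3)
    by (auto split: if_splits)
qed (use assms in blast)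

lemma conj_limit_eqI:
  assumes f: "almost_holomorphic_expansion f d g" and \<tau>: "\<tau> \<in> upper_half_plane"
  shows "conj_limit f \<tau> = g 0 \<tau>"
  unfolding conj_limit_def
proof (rule the_equality)
  show "w = g 0 \<tau>" if "\<exists>d g. almost_holomorphic_expansion f d g \<and> w = g 0 \<tau>" for w
    using that almost_holomorphic_expansion_unique[OF f _ \<tau>, of _ _ 0] by auto
qed (use f in blast)

subsection \<open>An infinite product with simple zeros on a lattice\<close>

lemma to_q_nonzero [simp]: "to_q z \<noteq> 0"
  by (simp add: to_q_def)

lemma to_q_add: "to_q (z + w) = to_q z * to_q w"
  by (simp add: to_q_def ring_distribs exp_add)

lemma to_q_of_int [simp]: "to_q (of_int n) = 1"
  unfolding to_q_def exp_eq_1 by (auto intro: exI[of _ n])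

lemma to_q_0 [simp]: "to_q 0 = 1"
  using to_q_of_int[of 0] by simp

lemma to_q_1 [simp]: "to_q 1 = 1"
  using to_q_of_int[of 1] by simp

lemma to_q_eq_1_iff: "to_q z = 1 \<longleftrightarrow> z \<in> \<int>"
proof
  assume "to_q z = 1"
  then obtain n :: int where "Im (2 * of_real pi * \<i> * z) = of_int (2 * n) * pi" "Re (2 * of_real pi * \<i> * z) = 0"
    by (auto simp: to_q_def exp_eq_1)
  then have "z = of_int n"
    by (intro complex_eqI) auto
  then show "z \<in> \<int>"
    by simp
qed (auto elim!: Ints_cases)

lemma to_q_power: "to_q z ^ n = to_q (of_nat n * z)"
  by (simp add: to_q_def exp_of_nat_mult[symmetric] algebra_simps)

lemma norm_to_q_less_1: "\<tau> \<in> upper_half_plane \<Longrightarrow> norm (to_q \<tau>) < 1"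
  by (simp add: to_q_def upper_half_plane_def)

lemma holomorphic_to_q [holomorphic_intros]:
  "f holomorphic_on S \<Longrightarrow> (\<lambda>z. to_q (f z)) holomorphic_on S"
  unfolding to_q_def by (intro holomorphic_intros)

text \<open>The theta series contain odd multiples of \<pi>iz, hence this square root of
  \<open>to_q\<close>, which has period 2 instead of 1.\<close>

definition epi :: "complex \<Rightarrow> complex" where
  "epi x = exp (of_real pi * \<i> * x)"

lemma epi_add: "epi (x + y) = epi x * epi y"
  by (simp add: epi_def exp_add ring_distribs)

lemma epi_nonzero [simp]: "epi x \<noteq> 0"
  by (simp add: epi_def)

lemma epi_0 [simp]: "epi 0 = 1"
  by (simp add: epi_def)

lemma to_q_conv_epi: "to_q z = epi (2 * z)"
  by (simp add: to_q_def epi_def mult_ac)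

lemma epi_even [simp]: "epi (2 * of_int n) = 1"
  by (simp add: to_q_conv_epi[symmetric])

text \<open>Products of \<open>epi\<close> are compared by merging the exponents and exhibiting the
  even integer by which they differ.\<close>

lemma epi_eqI: "x = y + 2 * of_int n \<Longrightarrow> epi x = epi y"
  by (simp add: epi_add)

lemma epi_1: "epi 1 = - 1"
  by (simp add: epi_def)

lemma epi_of_int: "epi (of_int n) = (-1) powi n"
proof -
  have "(-1) powi n = exp (of_real pi * \<i>) powi n"
    by simp
  also have "\<dots> = epi (of_int n)"
    by (simp only: epi_def exp_power_int mult_ac)
  finally show ?thesis ..
qed

lemma holomorphic_epi [holomorphic_intros]:
  "f holomorphic_on S \<Longrightarrow> (\<lambda>z. epi (f z)) holomorphic_on S"
  unfolding epi_def by (intro holomorphic_intros)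

lemma entire_if_holomorphic_on_balls:
  assumes "\<And>R. f holomorphic_on ball 0 R"
  shows "f holomorphic_on UNIV"
proof -
  have "f holomorphic_on (\<Union>R. ball 0 R)"
    by (intro holomorphic_on_UN_open assms open_ball)
  moreover have "(\<Union>R. ball 0 R) = (UNIV :: complex set)"
    by (auto intro: gt_ex)
  ultimately show ?thesis
    by simp
qed

text \<open>The infinite q-Pochhammer symbol of \<open>x\<close> with base \<open>q\<close>.\<close>

definition qprod :: "complex \<Rightarrow> complex \<Rightarrow> complex" where
  "qprod q x = (\<Prod>n. 1 - q ^ n * x)"

context
  fixes q :: complex
  assumes q: "norm q < 1"
begin

lemma convergent_qprod: "convergent_prod (\<lambda>n. 1 - q ^ n * x)"
proof (rule abs_convergent_prod_imp_convergent_prod)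
  have "summable (\<lambda>n. norm (1 - q ^ n * x - 1))"
    using q by (auto simp: norm_mult norm_power intro!: summable_mult2 summable_geometric)
  then show "abs_convergent_prod (\<lambda>n. 1 - q ^ n * x)"
    by (simp add: abs_convergent_prod_conv_summable)
qed

lemma qprod_rec: "qprod q x = (1 - x) * qprod q (q * x)"
  using has_prod_ignore_initial_segment'[OF convergent_qprod, of x 1]
  by (simp add: qprod_def has_prod_iff mult_ac)

lemma qprod_eq_0: "qprod q x = 0 \<Longrightarrow> \<exists>n. q ^ n * x = 1"
  using prodinf_nonzero[OF convergent_qprod, of x] unfolding qprod_def by fastforce

text \<open>On a disc of radius R the factors differ from 1 by at most |q|^n R, so the partial
  products converge uniformly there.\<close>

lemma qprod_entire: "qprod q holomorphic_on UNIV"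
proof -
  have "qprod q holomorphic_on ball 0 R" for R
  proof -
    have "uniformly_convergent_on (cball 0 R) (\<lambda>N x. \<Sum>n<N. norm (1 - q ^ n * x - 1))"
    proof (rule Weierstrass_m_test')
      show "norm (norm (1 - q ^ n * x - 1)) \<le> norm q ^ n * R" if "x \<in> cball 0 R" for n x
        using that by (simp add: norm_mult norm_power mult_left_mono)
      show "summable (\<lambda>n. norm q ^ n * R)"
        using q by (intro summable_mult2 summable_geometric) auto
    qed
    then have "uniformly_convergent_on (cball 0 R) (\<lambda>N x. \<Prod>n<N. 1 - q ^ n * x)"
      by (intro uniformly_convergent_on_prod') (auto intro!: continuous_intros)
    then obtain l where l: "uniform_limit (cball 0 R) (\<lambda>N x. \<Prod>n<N. 1 - q ^ n * x) l sequentially"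
      by (auto simp: uniformly_convergent_on_def)
    have "l x = qprod q x" if "x \<in> cball 0 R" for x
      using tendsto_uniform_limitI[OF l that] has_prod_imp_tendsto'[OF convergent_prod_has_prod[OF convergent_qprod]]
      unfolding qprod_def by (rule LIMSEQ_unique)
    moreover have "l holomorphic_on ball 0 R"
      by (rule holomorphic_uniform_limit[OF _ l])
         (auto intro!: always_eventually continuous_intros holomorphic_intros)
    ultimately show ?thesis
      by (auto elim!: holomorphic_transform)
  qed
  then show ?thesis
    by (rule entire_if_holomorphic_on_balls)
qed

end

lemma holomorphic_qprod [holomorphic_intros]:
  "f holomorphic_on S \<Longrightarrow> norm q < 1 \<Longrightarrow> (\<lambda>z. qprod q (f z)) holomorphic_on S"
  using holomorphic_on_compose_gen[OF _ qprod_entire] by (auto simp: o_def)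

text \<open>This is 2i sin(\<pi>z) times the product of (1 - q^n x)(1 - q^n / x) over n \<ge> 1,
  with x = \<open>to_q z\<close>: the product side of Jacobi's triple product identity without its
  factor independent of z.\<close>

definition lattice_prod :: "complex \<Rightarrow> complex \<Rightarrow> complex" where
  "lattice_prod \<tau> z =
     - epi (- z) * qprod (to_q \<tau>) (to_q z) * qprod (to_q \<tau>) (to_q (\<tau> - z))"

text \<open>Differentiating the shift relation at a zero of \<open>P\<close> shows that a multiplier
  without zeros transports simple zeros. This reduces simplicity on the whole lattice to the point
  0.\<close>

lemma deriv_nonzero_quasi_period:
  fixes P \<mu> :: "complex \<Rightarrow> complex"
  assumes P: "P holomorphic_on UNIV" and \<mu>: "\<mu> holomorphic_on UNIV" "\<And>z. \<mu> z \<noteq> 0"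
    and shift: "\<And>z. P (z + w) = \<mu> z * P z"
  shows "(P (z + w) = 0 \<and> deriv P (z + w) \<noteq> 0) \<longleftrightarrow> (P z = 0 \<and> deriv P z \<noteq> 0)"
proof (cases "P z = 0")
  case True
  have "((\<lambda>z. P (z + w)) has_field_derivative deriv P (z + w)) (at z)"
    by (rule DERIV_shift[THEN iffD1]) (rule holomorphic_derivI[OF P open_UNIV UNIV_I])
  moreover have "((\<lambda>z. \<mu> z * P z) has_field_derivative \<mu> z * deriv P z + deriv \<mu> z * P z) (at z)"
    using holomorphic_derivI[OF P open_UNIV UNIV_I[of z]] holomorphic_derivI[OF \<mu>(1) open_UNIV UNIV_I[of z]]
    by (auto intro!: derivative_eq_intros)
  ultimately have "deriv P (z + w) = \<mu> z * deriv P z"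
    using True by (simp add: shift DERIV_unique)
  with True \<mu>(2) show ?thesis
    by (simp add: shift)
qed (simp add: shift \<mu>(2))

context
  fixes \<tau> :: complex
  assumes \<tau>: "\<tau> \<in> upper_half_plane"
begin

lemma lattice_prod_entire: "lattice_prod \<tau> holomorphic_on UNIV"
  unfolding lattice_prod_def[abs_def] by (intro holomorphic_intros norm_to_q_less_1 \<tau>)

lemma lattice_prod_plus_1: "lattice_prod \<tau> (z + 1) = - lattice_prod \<tau> z"
proof -
  have "epi (- (z + 1)) = epi (1 - z)"
    by (rule epi_eqI[of _ _ "- 1"]) simp
  then have "epi (- (z + 1)) = - epi (- z)"
    using epi_add[of 1 "- z"] by (simp add: epi_1)
  moreover have "to_q (\<tau> - (z + 1)) = to_q (\<tau> - z)"
    using to_q_add[of "\<tau> - (z + 1)" 1] by simp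
  ultimately show ?thesis
    by (simp add: lattice_prod_def to_q_add)
qed

text \<open>With x = \<open>to_q z\<close>, the shift removes the factor 1 - x from the first
  product and adds 1 - 1/x to the second, and 1 - 1/x = -(1 - x)/x. The proof moves factors around
  instead of dividing by 1 - x, which may be 0.\<close>

lemma lattice_prod_plus_tau:
  "lattice_prod \<tau> (z + \<tau>) = - epi (- \<tau> - 2 * z) * lattice_prod \<tau> z"
proof -
  note rec = qprod_rec[OF norm_to_q_less_1[OF \<tau>]]
  have 1: "qprod (to_q \<tau>) (to_q z) = (1 - to_q z) * qprod (to_q \<tau>) (to_q (z + \<tau>))"
    by (subst rec) (simp add: to_q_add mult.commute)
  have 2: "qprod (to_q \<tau>) (to_q (- z)) = (1 - to_q (- z)) * qprod (to_q \<tau>) (to_q (\<tau> - z))"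
    by (subst rec) (simp add: to_q_add[symmetric])
  have 3: "1 - to_q (- z) = - to_q (- z) * (1 - to_q z)"
    using to_q_add[of "- z" z] by (simp add: algebra_simps)
  have 4: "epi (- (z + \<tau>)) * to_q (- z) =
      epi (- \<tau> - 2 * z) * epi (- z)"
    by (simp add: to_q_conv_epi epi_add[symmetric] algebra_simps)
  have "lattice_prod \<tau> (z + \<tau>) = (epi (- (z + \<tau>)) * to_q (- z)) *
      ((1 - to_q z) * qprod (to_q \<tau>) (to_q (z + \<tau>))) * qprod (to_q \<tau>) (to_q (\<tau> - z))"
    by (simp add: lattice_prod_def 2 3)
  also have "\<dots> = - epi (- \<tau> - 2 * z) * lattice_prod \<tau> z"
    unfolding 1[symmetric] 4 by (simp add: lattice_prod_def)
  finally show ?thesis .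
qed

lemma lattice_prod_eq_0D:
  assumes "lattice_prod \<tau> z = 0"
  obtains k n :: int where "z = of_int k * \<tau> + of_int n"
proof -
  note zero = qprod_eq_0[OF norm_to_q_less_1[OF \<tau>]]
  consider "qprod (to_q \<tau>) (to_q z) = 0" | "qprod (to_q \<tau>) (to_q (\<tau> - z)) = 0"
    using assms by (auto simp: lattice_prod_def)
  then show ?thesis
  proof cases
    case 1
    then obtain n where "to_q (of_nat n * \<tau> + z) = 1"
      using zero by (auto simp: to_q_add to_q_power)
    then obtain m where "of_nat n * \<tau> + z = of_int m"
      by (auto simp: to_q_eq_1_iff elim: Ints_cases)
    then have "z = of_int (- int n) * \<tau> + of_int m"
      by (simp add: algebra_simps)
    then show ?thesis
      by (rule that)
  next
    case 2
    then obtain n where "to_q (of_nat n * \<tau> + (\<tau> - z)) = 1"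
      using zero by (auto simp: to_q_add to_q_power)
    then obtain m where "of_nat n * \<tau> + (\<tau> - z) = of_int m"
      by (auto simp: to_q_eq_1_iff elim: Ints_cases)
    then have "z = of_int (int n + 1) * \<tau> + of_int (- m)"
      by (simp add: algebra_simps)
    then show ?thesis
      by (rule that)
  qed
qed

lemma lattice_prod_0: "lattice_prod \<tau> 0 = 0"
  using qprod_rec[OF norm_to_q_less_1[OF \<tau>], of 1] by (simp add: lattice_prod_def)

text \<open>The vanishing factor \<open>to_q z - 1\<close> is split off. The cofactor
  \<open>R\<close> is nonzero at 0, because no positive power of q equals 1.\<close>

lemma deriv_lattice_prod_0: "deriv (lattice_prod \<tau>) 0 \<noteq> 0"
proof -
  note q = norm_to_q_less_1[OF \<tau>]
  define R where "R z = epi (- z) * qprod (to_q \<tau>) (to_q (\<tau> + z)) * qprod (to_q \<tau>) (to_q (\<tau> - z))" for z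
  have "R holomorphic_on UNIV"
    unfolding R_def[abs_def] by (intro holomorphic_intros q)
  then have "(R has_field_derivative deriv R 0) (at 0)"
    by (rule holomorphic_derivI) auto
  then have "((\<lambda>z. (to_q z - 1) * R z) has_field_derivative 2 * of_real pi * \<i> * R 0) (at 0)"
    unfolding to_q_def by (auto intro!: derivative_eq_intros)
  moreover have "(\<lambda>z. (to_q z - 1) * R z) = lattice_prod \<tau>"
  proof
    fix z
    have eq: "qprod (to_q \<tau>) (to_q z) = (1 - to_q z) * qprod (to_q \<tau>) (to_q (\<tau> + z))"
      by (subst qprod_rec[OF q]) (simp add: to_q_add)
    show "(to_q z - 1) * R z = lattice_prod \<tau> z"
      unfolding lattice_prod_def R_def eq by (simp add: algebra_simps)
  qed
  ultimately have "deriv (lattice_prod \<tau>) 0 = 2 * of_real pi * \<i> * R 0"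
    by (simp add: DERIV_imp_deriv)
  moreover have "qprod (to_q \<tau>) (to_q \<tau>) \<noteq> 0"
  proof
    assume "qprod (to_q \<tau>) (to_q \<tau>) = 0"
    then obtain n where "to_q \<tau> ^ Suc n = 1"
      using qprod_eq_0[OF q] by (metis power_Suc2)
    then have "norm (to_q \<tau>) ^ Suc n = 1"
      by (metis norm_one norm_power)
    with q show False
      using power_Suc_less_one[of "norm (to_q \<tau>)" n] by simp
  qed
  ultimately show ?thesis
    by (simp add: R_def)
qed

lemma lattice_prod_simple_zero:
  "lattice_prod \<tau> (of_int k * \<tau> + of_int n) = 0" "deriv (lattice_prod \<tau>) (of_int k * \<tau> + of_int n) \<noteq> 0"
proof -
  let ?Z = "\<lambda>z. lattice_prod \<tau> z = 0 \<and> deriv (lattice_prod \<tau>) z \<noteq> 0"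
  have "?Z (z + 1) = ?Z z" for z
    by (rule deriv_nonzero_quasi_period[where \<mu> = "\<lambda>_. -1"])
       (auto simp: lattice_prod_plus_1 lattice_prod_entire)
  moreover have "?Z (z + \<tau>) = ?Z z" for z
    by (rule deriv_nonzero_quasi_period[where \<mu> = "\<lambda>z. - epi (- \<tau> - 2 * z)"])
       (auto simp: lattice_prod_plus_tau intro!: holomorphic_intros lattice_prod_entire)
  \<comment> \<open>Here \<open>periodic_of_int\<close> is applied to the predicate
    \<open>?Z\<close>, with truth values as its values.\<close>
  ultimately have "?Z (0 + of_int k * \<tau> + of_int n * 1) = ?Z 0"
    using periodic_of_int[of ?Z \<tau>] periodic_of_int[of ?Z 1] by metis
  then show "lattice_prod \<tau> (of_int k * \<tau> + of_int n) = 0"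
    "deriv (lattice_prod \<tau>) (of_int k * \<tau> + of_int n) \<noteq> 0"
    using lattice_prod_0 deriv_lattice_prod_0 by auto
qed

lemma deriv_lattice_prod_nonzero: "lattice_prod \<tau> z = 0 \<Longrightarrow> deriv (lattice_prod \<tau>) z \<noteq> 0"
  by (metis lattice_prod_eq_0D lattice_prod_simple_zero(2))

text \<open>The quotient by \<open>lattice_prod \<tau>\<close> is entire, and it has periods 2 and
  2\<tau> because both functions have the same multipliers. Doubling the periods removes the signs
  from the multipliers, so no parities of matrix entries have to be discussed for the modular
  transforms.\<close>

lemma entire_multiple_of_lattice_prod:
  assumes f: "f holomorphic_on UNIV"
    and zeros: "\<And>k n :: int. f (of_int k * \<tau> + of_int n) = 0"
    and shift_2: "\<And>z. f (z + 2) = f z"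
    and shift_2tau: "\<And>z. f (z + 2 * \<tau>) = epi (- 4 * (\<tau> + z)) * f z"
  obtains c where "\<And>z. f z = c * lattice_prod \<tau> z"
proof -
  let ?P = "lattice_prod \<tau>"
  obtain h where h: "h holomorphic_on UNIV" and fh: "\<And>z. f z = ?P z * h z"
    using entire_div_simple_zeros[OF f lattice_prod_entire] zeros deriv_lattice_prod_nonzero lattice_prod_eq_0D
    by metis
  have shift_h: "(\<lambda>z. h (z + w)) holomorphic_on UNIV" for w
  proof -
    have "(\<lambda>z. z + w) holomorphic_on UNIV"
      by (intro holomorphic_intros)
    from holomorphic_on_compose_gen[OF this h] show ?thesis
      by (simp add: o_def)
  qed
  have P2: "?P (z + 2) = ?P z" for z
    using lattice_prod_plus_1[of z] lattice_prod_plus_1[of "z + 1"] by (simp add: add.assoc)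
  have "?P z * (h (z + 2) - h z) = 0" for z
    using shift_2[of z] by (simp add: fh P2 algebra_simps)
  then have h2: "h (z + 2) = h z" for z
    using eq_0_if_mult_simple_zeros_eq_0[OF holomorphic_on_diff[OF shift_h[of "2"] h]
        lattice_prod_entire deriv_lattice_prod_nonzero]
    by simp
  have P2tau: "?P (z + 2 * \<tau>) = epi (- 4 * (\<tau> + z)) * ?P z" for z
  proof -
    have "epi (- \<tau> - 2 * (z + \<tau>)) * epi (- \<tau> - 2 * z) =
        epi (- 4 * (\<tau> + z))"
      by (simp add: epi_add[symmetric] algebra_simps)
    then show ?thesis
      using lattice_prod_plus_tau[of z] lattice_prod_plus_tau[of "z + \<tau>"]
      by (simp add: add.assoc mult_2[symmetric])
  qed
  have "?P z * (h (z + 2 * \<tau>) - h z) = 0" for z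
    using shift_2tau[of z] unfolding fh P2tau by simp
  then have h2tau: "h (z + 2 * \<tau>) = h z" for z
    using eq_0_if_mult_simple_zeros_eq_0[OF holomorphic_on_diff[OF shift_h[of "2 * \<tau>"] h]
        lattice_prod_entire deriv_lattice_prod_nonzero]
    by simp
  obtain c where "h z = c" for z
    using doubly_periodic_entire_constant[OF h _ _ h2 h2tau] \<tau> by (auto simp: upper_half_plane_def)
  then have "f z = c * lattice_prod \<tau> z" for z
    by (simp add: fh mult.commute)
  then show ?thesis
    by (rule that)
qed

end

subsection \<open>Series of exponentials\<close>

lemma exp_has_sum:
  fixes x :: "'a :: {real_normed_field, banach}"
  shows "((\<lambda>k. x ^ k / fact k) has_sum exp x) UNIV"
proof (rule norm_summable_imp_has_sum)
  show "(\<lambda>k. x ^ k / fact k) sums exp x"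
    using exp_converges[of x] by (simp add: scaleR_conv_of_real field_simps)
  show "summable (\<lambda>k. norm (x ^ k / fact k))"
    using summable_norm_exp[of x] by (simp add: scaleR_conv_of_real field_simps)
qed

text \<open>The left side divided by k! is a single term of the exponential series.\<close>

lemma power_le_fact_exp:
  fixes x :: real
  assumes "x \<ge> 0"
  shows "x ^ k \<le> fact k * exp x"
proof -
  have "(\<Sum>k\<in>{k}. x ^ k / fact k) \<le> exp x"
    by (rule finite_sum_le_has_sum[OF exp_has_sum]) (use assms in auto)
  then show ?thesis
    by (simp add: field_simps)
qed

text \<open>Expand each exponential and interchange the two sums. The double family is absolutely
  summable by the hypothesis at R = |z|, and the inner sums over \<open>m\<close> by the hypothesis
  at R = 1.\<close>

lemma exponential_series_sums:
  fixes a b :: "'i \<Rightarrow> complex"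
  assumes summable: "\<And>R. R \<ge> 0 \<Longrightarrow> (\<lambda>m. norm (a m) * exp (norm (b m) * R)) summable_on UNIV"
  shows "(\<lambda>k. (\<Sum>\<^sub>\<infinity>m. a m * b m ^ k) / fact k * z ^ k) sums (\<Sum>\<^sub>\<infinity>m. a m * exp (b m * z))"
proof -
  define f where "f = (\<lambda>(m, k). a m * ((b m * z) ^ k / fact k))"
  have "(\<lambda>p. norm (f p)) summable_on (UNIV \<times> UNIV)"
  proof (rule summable_on_SigmaI)
    show "((\<lambda>k. norm (f (m, k))) has_sum norm (a m) * exp (norm (b m) * norm z)) UNIV" for m
      unfolding f_def using has_sum_cmult_right[OF exp_has_sum, of "norm (a m)" "norm (b m) * norm z"]
      by (simp add: norm_mult norm_divide norm_power)
  qed (use summable[of "norm z"] in auto)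
  then have "f summable_on (UNIV \<times> UNIV)"
    by (rule abs_summable_summable)
  then obtain S where S: "(f has_sum S) (UNIV \<times> UNIV)"
    by (auto simp: summable_on_def)
  have "((\<lambda>m. a m * exp (b m * z)) has_sum S) UNIV"
  proof (rule has_sum_Sigma'[OF S])
    show "((\<lambda>k. f (m, k)) has_sum a m * exp (b m * z)) UNIV" for m
      unfolding f_def using has_sum_cmult_right[OF exp_has_sum, of "a m" "b m * z"] by simp
  qed
  then have S_eq: "(\<Sum>\<^sub>\<infinity>m. a m * exp (b m * z)) = S"
    by (rule infsumI)
  have swap: "((\<lambda>(k, m). f (m, k)) has_sum S) (UNIV \<times> UNIV)"
    using S by (subst (asm) has_sum_swap)
  have "((\<lambda>k. (\<Sum>\<^sub>\<infinity>m. a m * b m ^ k) / fact k * z ^ k) has_sum S) UNIV"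
  proof (rule has_sum_Sigma'[OF swap])
    fix k
    have "(\<lambda>m. norm (a m * b m ^ k)) summable_on UNIV"
    proof (rule Infinite_Sum.abs_summable_on_comparison_test')
      show "(\<lambda>m. fact k * (norm (a m) * exp (norm (b m) * 1))) summable_on UNIV"
        by (intro summable_on_cmult_right summable) auto
      show "norm (a m * b m ^ k) \<le> fact k * (norm (a m) * exp (norm (b m) * 1))" for m
        using mult_left_mono[OF power_le_fact_exp[of "norm (b m)" k], of "norm (a m)"]
        by (simp add: norm_mult norm_power mult_ac)
    qed
    then have "(\<lambda>m. a m * b m ^ k) summable_on UNIV"
      by (rule abs_summable_summable)
    then have "((\<lambda>m. a m * b m ^ k) has_sum (\<Sum>\<^sub>\<infinity>m. a m * b m ^ k)) UNIV"
      by (rule has_sum_infsum)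
    from has_sum_cmult_left[OF this, of "z ^ k / fact k"]
    show "((\<lambda>m. (\<lambda>(k, m). f (m, k)) (k, m)) has_sum (\<Sum>\<^sub>\<infinity>m. a m * b m ^ k) / fact k * z ^ k) UNIV"
      by (simp add: f_def power_mult_distrib mult_ac)
  qed
  then show ?thesis
    unfolding S_eq by (rule has_sum_imp_sums)
qed

text \<open>The quotient of consecutive terms is \<open>exp C * r ^ k\<close>, which tends to
  0.\<close>

lemma summable_exp_times_quadratic_power:
  fixes r C :: real
  assumes r: "0 \<le> r" "r < 1"
  shows "summable (\<lambda>k. exp (C * real k) * r ^ (k * (k - 1) div 2))"
proof -
  let ?f = "\<lambda>k. exp (C * real k) * r ^ (k * (k - 1) div 2)"
  have "(\<lambda>k. exp C * r ^ k) \<longlonglongrightarrow> exp C * 0"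
    using r by (intro tendsto_mult tendsto_const LIMSEQ_power_zero) auto
  then have "eventually (\<lambda>k. exp C * r ^ k < 1 / 2) sequentially"
    by (rule order_tendstoD) auto
  then obtain N where N: "\<And>k. k \<ge> N \<Longrightarrow> exp C * r ^ k < 1 / 2"
    by (auto simp: eventually_sequentially)
  show ?thesis
  proof (rule summable_ratio_test)
    fix k assume k: "k \<ge> N"
    have "Suc k * (Suc k - 1) div 2 = k * (k - 1) div 2 + k"
      by (cases k) auto
    then have "?f (Suc k) = (exp C * r ^ k) * ?f k"
      by (simp add: power_add exp_add ring_distribs mult_ac)
    also have "norm \<dots> \<le> 1 / 2 * norm (?f k)"
      using N[OF k] r unfolding norm_mult[of "exp C * r ^ k"] by (intro mult_right_mono) auto
    finally show "norm (?f (Suc k)) \<le> 1 / 2 * norm (?f k)" .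
  qed auto
qed

lemma summable_on_exp_times_quadratic_power:
  fixes r C :: real and e :: "int \<Rightarrow> nat"
  assumes r: "0 \<le> r" "r < 1" and e: "\<And>m. \<bar>m\<bar> * (\<bar>m\<bar> - 1) \<le> 2 * int (e m)"
  shows "(\<lambda>m. exp (C * \<bar>real_of_int m\<bar>) * r ^ e m) summable_on UNIV"
proof -
  define g where "g m = exp (C * \<bar>real_of_int m\<bar>) * r ^ (nat \<bar>m\<bar> * (nat \<bar>m\<bar> - 1) div 2)" for m
  have nat: "(\<lambda>k. exp (C * real k) * r ^ (k * (k - 1) div 2)) summable_on UNIV"
    using r by (intro summable_nonneg_imp_summable_on summable_exp_times_quadratic_power) auto
  have "g summable_on range int"
    using nat by (subst summable_on_reindex) (auto simp: g_def o_def)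
  moreover have "g summable_on range (\<lambda>k. - int k)"
    using nat by (subst summable_on_reindex) (auto simp: g_def o_def inj_on_def)
  ultimately have "g summable_on (range int \<union> range (\<lambda>k. - int k))"
    by (rule summable_on_union)
  moreover have "range int \<union> range (\<lambda>k. - int k) = UNIV"
    by (auto intro: int_cases2)
  ultimately have g: "g summable_on UNIV"
    by simp
  show ?thesis
  proof (rule summable_on_comparison_test[OF g])
    fix m :: int
    have "int (nat \<bar>m\<bar> * (nat \<bar>m\<bar> - 1)) = \<bar>m\<bar> * (\<bar>m\<bar> - 1)"
      by (cases "m = 0") (auto simp: of_nat_diff nat_le_iff)
    then have "nat \<bar>m\<bar> * (nat \<bar>m\<bar> - 1) \<le> 2 * e m"
      using e[of m] by linarith
    then have "nat \<bar>m\<bar> * (nat \<bar>m\<bar> - 1) div 2 \<le> e m"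
      by linarith
    then show "exp (C * \<bar>real_of_int m\<bar>) * r ^ e m \<le> g m"
      using r unfolding g_def by (intro mult_left_mono power_decreasing) auto
  qed (use r in auto)
qed

section \<open>Fourier coefficients\<close>

lemma epi_integral: "((\<lambda>x. epi (2 * of_int k * of_real x)) has_integral (if k = 0 then 1 else 0)) {0..1}"
proof (cases "k = 0")
  case True
  then show ?thesis
    using has_integral_const_real[of "1 :: complex" 0 1] by simp
next
  case False
  define c where "c = of_real pi * \<i> * (2 * of_int k)"
  have "c \<noteq> 0"
    using False by (simp add: c_def)
  have "((\<lambda>x. exp (c * of_real x)) has_integral (exp (c * of_real 1) / c - exp (c * of_real 0) / c)) {0..1}"
  proof (rule fundamental_theorem_of_calculus)
    fix x :: real
    have "((\<lambda>z. exp (c * z) / c) has_field_derivative exp (c * of_real x)) (at (of_real x))"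
      using \<open>c \<noteq> 0\<close> by (auto intro!: derivative_eq_intros)
    from has_vector_derivative_real_field[OF this]
    show "((\<lambda>x. exp (c * of_real x) / c) has_vector_derivative exp (c * of_real x)) (at x within {0..1})" .
  qed auto
  moreover have "exp c = 1"
    using epi_even[of k] by (simp add: c_def epi_def)
  ultimately show ?thesis
    using False by (simp add: epi_def c_def mult_ac)
qed

lemma fourier_series_integral:
  fixes a :: "'i \<Rightarrow> complex" and k :: "'i \<Rightarrow> int"
  assumes a: "(\<lambda>m. norm (a m)) summable_on UNIV"
  shows "((\<lambda>x. \<Sum>\<^sub>\<infinity>m. a m * epi (2 * of_int (k m) * of_real x)) has_integral
           (\<Sum>\<^sub>\<infinity>m. if k m = 0 then a m else 0)) {0..1}"
proof -
  let ?f = "\<lambda>F x. \<Sum>m\<in>F. a m * epi (2 * of_int (k m) * of_real x)"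
  let ?g = "\<lambda>x. \<Sum>\<^sub>\<infinity>m. a m * epi (2 * of_int (k m) * of_real x)"
  have "uniform_limit {0..1} ?f ?g (finite_subsets_at_top UNIV)"
    by (rule Weierstrass_m_test_general[OF _ a]) (simp add: norm_mult epi_def)
  then obtain I J where I: "\<And>F. (?f F has_integral I F) {0..1}" and J: "(?g has_integral J) {0..1}"
    and lim: "(I \<longlongrightarrow> J) (finite_subsets_at_top UNIV)"
    by (rule uniform_limit_integral) (auto simp: epi_def intro!: continuous_intros)
  have "I F = (\<Sum>m\<in>F. if k m = 0 then a m else 0)" for F
  \<comment> \<open>For infinite \<open>F\<close> every sum over \<open>F\<close> is 0 by
    convention, and so is its integral.\<close>
  proof (cases "finite F")
    case True
    have "(?f F has_integral (\<Sum>m\<in>F. a m * (if k m = 0 then 1 else 0))) {0..1}"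
      by (intro has_integral_sum True has_integral_mult_right epi_integral)
    then show ?thesis
      using has_integral_unique[OF I] by (simp add: if_distrib cong: if_cong)
  qed (use I[of F] has_integral_unique[OF has_integral_0] in auto)
  \<comment> \<open>Convergence of the integrals \<open>I F\<close> along the finite sets
    \<open>F\<close> is exactly what \<open>has_sum\<close> means.\<close>
  then have "((\<lambda>m. if k m = 0 then a m else 0) has_sum J) UNIV"
    using lim unfolding has_sum_def by presburger
  then show ?thesis
    using J infsumI by blast
qed

subsection \<open>Theta series\<close>

definition theta_coeff :: "int \<Rightarrow> complex \<Rightarrow> int \<Rightarrow> complex" where
  "theta_coeff K q m = (-1) powi m * q powi (m * (K * m + 1) div 2)"

definition theta :: "int \<Rightarrow> complex \<Rightarrow> complex \<Rightarrow> complex" where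
  "theta K \<tau> z = (\<Sum>\<^sub>\<infinity>m. theta_coeff K (to_q \<tau>) m * epi (of_int (2 * K * m + 1) * z))"

text \<open>Up to the factor (\<pi>i)^k / k! this is the k-th Taylor coefficient of
  \<open>theta K\<close> at z = 0. The numerators and denominators of \<open>U\<close> and
  \<open>V\<close> are such moments, up to a factor 2 in the case of \<open>U\<close>.\<close>

definition theta_moment :: "int \<Rightarrow> nat \<Rightarrow> complex \<Rightarrow> complex" where
  "theta_moment K k q = (\<Sum>\<^sub>\<infinity>m. theta_coeff K q m * of_int (2 * K * m + 1) ^ k)"

lemma theta_coeff_0 [simp]: "theta_coeff K q 0 = 1"
  by (simp add: theta_coeff_def)

text \<open>A lower bound independent of \<open>K\<close>, so that one comparison series serves for
  all theta series.\<close>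

lemma theta_exponent_ge:
  fixes K m :: int
  assumes "K \<ge> 1"
  shows "\<bar>m\<bar> * (\<bar>m\<bar> - 1) \<le> m * (K * m + 1)"
proof -
  have "\<bar>m\<bar> * (\<bar>m\<bar> - 1) = m * m - \<bar>m\<bar>"
    by (simp add: algebra_simps abs_mult[symmetric])
  also have "\<dots> \<le> K * (m * m) + m"
    using mult_right_mono[of 1 K "m * m"] assms by simp
  finally show ?thesis
    by (simp add: algebra_simps)
qed

lemma theta_exponent_nonneg: "K \<ge> 1 \<Longrightarrow> 0 \<le> m * (K * m + 1)" for K m :: int
  by (rule order.trans[OF _ theta_exponent_ge]) (cases "m = 0"; simp)+

lemma theta_exponent_even: "odd K \<Longrightarrow> even (m * (K * m + 1))" for K m :: int
  by auto

context
  fixes K :: int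
  assumes K: "K \<ge> 1" "odd K"
begin

lemma theta_coeff_conv_power: "theta_coeff K q m = (-1) powi m * q ^ nat (m * (K * m + 1) div 2)"
  using theta_exponent_nonneg[OF K(1), of m]
  by (simp add: theta_coeff_def power_int_def)

lemma norm_theta_coeff: "norm (theta_coeff K q m) = norm q ^ nat (m * (K * m + 1) div 2)"
  by (simp add: theta_coeff_conv_power norm_mult norm_power norm_power_int)

lemma theta_coeff_conv_epi: "theta_coeff K (to_q \<tau>) m = epi (of_int m + \<tau> * of_int (m * (K * m + 1)))"
proof -
  let ?e = "m * (K * m + 1) div 2"
  have e: "m * (K * m + 1) = 2 * ?e"
    using theta_exponent_even[OF K(2), of m] by simp
  have "to_q \<tau> powi ?e = epi (\<tau> * of_int (2 * ?e))"
    by (simp add: to_q_conv_epi epi_def exp_power_int mult_ac)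
  then show ?thesis
    unfolding theta_coeff_def epi_add epi_of_int by (simp flip: e)
qed

lemma theta_coeff_summable:
  assumes "norm q < 1"
  shows "(\<lambda>m. norm (theta_coeff K q m) * exp (C * \<bar>real_of_int m\<bar>)) summable_on UNIV"
proof -
  have "\<bar>m\<bar> * (\<bar>m\<bar> - 1) \<le> 2 * int (nat (m * (K * m + 1) div 2))" for m
    using theta_exponent_ge[OF K(1), of m] theta_exponent_nonneg[OF K(1), of m]
      theta_exponent_even[OF K(2), of m] by simp
  then show ?thesis
    using summable_on_exp_times_quadratic_power[of "norm q" "\<lambda>m. nat (m * (K * m + 1) div 2)" C] assms
    by (simp add: norm_theta_coeff mult.commute)
qed

lemma theta_coeff_summable':
  assumes q: "norm q < 1" and R: "R \<ge> 0"
  shows "(\<lambda>m. norm (theta_coeff K q m) * exp (\<bar>of_int (2 * K * m + 1)\<bar> * R)) summable_on UNIV"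
proof -
  have "(\<lambda>m. exp R * (norm (theta_coeff K q m) * exp (of_int (2 * K) * R * \<bar>real_of_int m\<bar>))) summable_on UNIV"
    by (intro summable_on_cmult_right theta_coeff_summable q)
  then show ?thesis
  proof (rule summable_on_comparison_test)
    fix m :: int
    have "\<bar>2 * K * m + 1\<bar> \<le> 2 * K * \<bar>m\<bar> + 1"
      using K(1) abs_triangle_ineq[of "2 * K * m" 1] by (simp add: abs_mult)
    then have "real_of_int \<bar>2 * K * m + 1\<bar> \<le> of_int (2 * K * \<bar>m\<bar> + 1)"
      by (subst of_int_le_iff)
    then have "\<bar>of_int (2 * K * m + 1)\<bar> \<le> of_int (2 * K) * \<bar>real_of_int m\<bar> + 1"
      by simp
    then have "\<bar>of_int (2 * K * m + 1)\<bar> * R \<le> (of_int (2 * K) * \<bar>real_of_int m\<bar> + 1) * R"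
      using R by (rule mult_right_mono)
    then have "exp (\<bar>of_int (2 * K * m + 1)\<bar> * R) \<le> exp R * exp (of_int (2 * K) * R * \<bar>real_of_int m\<bar>)"
      by (simp add: exp_add[symmetric] algebra_simps)
    from mult_left_mono[OF this, of "norm (theta_coeff K q m)"]
    show "norm (theta_coeff K q m) * exp (\<bar>of_int (2 * K * m + 1)\<bar> * R) \<le>
        exp R * (norm (theta_coeff K q m) * exp (of_int (2 * K) * R * \<bar>real_of_int m\<bar>))"
      by (simp add: mult_ac)
  qed auto
qed

lemma theta_moment_term_bound:
  "norm (theta_coeff K q m * of_int (2 * K * m + 1) ^ k) \<le>
     fact k * (norm (theta_coeff K q m) * exp (\<bar>of_int (2 * K * m + 1)\<bar> * 1))"
proof -
  have "\<bar>real_of_int (2 * K * m + 1)\<bar> ^ k \<le> fact k * exp \<bar>real_of_int (2 * K * m + 1)\<bar>"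
    by (rule power_le_fact_exp) auto
  from mult_left_mono[OF this, of "norm (theta_coeff K q m)"] show ?thesis
    unfolding norm_mult norm_power norm_of_int by (simp add: mult_ac)
qed

lemma theta_moment_summable:
  assumes "norm q < 1"
  shows "(\<lambda>m. norm (theta_coeff K q m * of_int (2 * K * m + 1) ^ k)) summable_on UNIV"
proof (rule Infinite_Sum.abs_summable_on_comparison_test'[OF _ theta_moment_term_bound])
  show "(\<lambda>m. fact k * (norm (theta_coeff K q m) * exp (\<bar>of_int (2 * K * m + 1)\<bar> * 1))) summable_on UNIV"
    by (intro summable_on_cmult_right theta_coeff_summable' assms) auto
qed

text \<open>The series converges uniformly on each closed disc of radius r < 1, and the open discs
  of these radii exhaust the unit disc.\<close>

lemma theta_moment_holomorphic: "theta_moment K k holomorphic_on ball 0 1"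
proof -
  have "theta_moment K k holomorphic_on ball 0 r" if r: "0 \<le> r" "r < 1" for r
  proof -
    \<comment> \<open>The norm of a coefficient grows with |q|, so its value at the real point q = r
      dominates it on the disc.\<close>
    let ?M = "\<lambda>m. fact k * (norm (theta_coeff K (of_real r) m) * exp (\<bar>of_int (2 * K * m + 1)\<bar> * 1))"
    have "uniform_limit (cball 0 r) (\<lambda>F q. \<Sum>m\<in>F. theta_coeff K q m * of_int (2 * K * m + 1) ^ k)
        (theta_moment K k) (finite_subsets_at_top UNIV)"
      unfolding theta_moment_def[abs_def]
    proof (rule Weierstrass_m_test_general)
      show "?M summable_on UNIV"
        using r by (intro summable_on_cmult_right theta_coeff_summable') auto
      fix m q assume "q \<in> cball (0 :: complex) r"
      then have "norm (theta_coeff K q m) \<le> norm (theta_coeff K (of_real r) m)"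
        using r by (simp add: norm_theta_coeff power_mono)
      then show "norm (theta_coeff K q m * of_int (2 * K * m + 1) ^ k) \<le> ?M m"
        by (intro order.trans[OF theta_moment_term_bound] mult_left_mono mult_right_mono) auto
    qed
    then show ?thesis
      by (rule holomorphic_uniform_limit[rotated])
         (auto simp: theta_coeff_conv_power intro!: always_eventually continuous_intros holomorphic_intros)
  qed
  then have "theta_moment K k holomorphic_on (\<Union>r\<in>{0..<1}. ball 0 r)"
    by (intro holomorphic_on_UN_open) auto
  moreover have "(\<Union>r\<in>{0..<1}. ball 0 r) = ball (0 :: complex) 1"
  proof safe
    fix q :: complex assume "q \<in> ball 0 1"
    then obtain r where "norm q < r" "r < 1"
      using dense[of "norm q" 1] by auto
    moreover from this have "0 \<le> r"
      by (meson norm_ge_zero order.trans less_imp_le)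
    ultimately show "q \<in> (\<Union>r\<in>{0..<1}. ball 0 r)"
      by (intro UN_I[of r]) auto
  qed auto
  ultimately show ?thesis
    by simp
qed

lemma theta_sums:
  assumes "\<tau> \<in> upper_half_plane"
  shows "(\<lambda>k. (of_real pi * \<i>) ^ k * theta_moment K k (to_q \<tau>) / fact k * z ^ k) sums theta K \<tau> z"
proof -
  let ?b = "\<lambda>m. of_real pi * \<i> * of_int (2 * K * m + 1)"
  have "(\<lambda>k. (\<Sum>\<^sub>\<infinity>m. theta_coeff K (to_q \<tau>) m * ?b m ^ k) / fact k * z ^ k) sums
      (\<Sum>\<^sub>\<infinity>m. theta_coeff K (to_q \<tau>) m * exp (?b m * z))"
  proof (rule exponential_series_sums)
    fix R :: real assume "R \<ge> 0"
    then have "(\<lambda>m. norm (theta_coeff K (to_q \<tau>) m) * exp (\<bar>of_int (2 * K * m + 1)\<bar> * (pi * R))) summable_on UNIV"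
      by (intro theta_coeff_summable' norm_to_q_less_1 assms) auto
    moreover have "norm (?b m) * R = \<bar>of_int (2 * K * m + 1)\<bar> * (pi * R)" for m
      unfolding norm_mult norm_of_int by simp
    ultimately show "(\<lambda>m. norm (theta_coeff K (to_q \<tau>) m) * exp (norm (?b m) * R)) summable_on UNIV"
      by (simp only:)
  qed
  moreover have "(\<Sum>\<^sub>\<infinity>m. theta_coeff K (to_q \<tau>) m * ?b m ^ k) = (of_real pi * \<i>) ^ k * theta_moment K k (to_q \<tau>)" for k
    unfolding theta_moment_def power_mult_distrib infsum_cmult_right'[symmetric] by (simp only: mult_ac)
  moreover have "(\<Sum>\<^sub>\<infinity>m. theta_coeff K (to_q \<tau>) m * exp (?b m * z)) = theta K \<tau> z"
    unfolding theta_def epi_def by (simp only: mult_ac)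
  ultimately show ?thesis
    by simp
qed

lemma theta_entire:
  assumes "\<tau> \<in> upper_half_plane"
  shows "theta K \<tau> holomorphic_on UNIV"
  using theta_sums[OF assms] by (intro entire_if_holomorphic_on_balls
      power_series_holomorphic[where a = "\<lambda>k. (of_real pi * \<i>) ^ k * theta_moment K k (to_q \<tau>) / fact k"]) auto

lemma theta_has_fps_expansion:
  assumes "\<tau> \<in> upper_half_plane"
  shows "theta K \<tau> has_fps_expansion Abs_fps (\<lambda>k. (of_real pi * \<i>) ^ k * theta_moment K k (to_q \<tau>) / fact k)"
  using theta_sums[OF assms] by (intro has_fps_expansionI) auto

text \<open>Completing the square: the shift by k\<tau> + n turns the term of index m into that of
  index m + k, up to a factor independent of m.\<close>

lemma theta_shift:
  "theta K \<tau> (z + of_int k * \<tau> + of_int n) =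
     epi (of_int (k + n) - of_int K * of_int k ^ 2 * \<tau> - 2 * of_int K * of_int k * z) * theta K \<tau> z"
proof -
  let ?T = "\<lambda>m z. theta_coeff K (to_q \<tau>) m * epi (of_int (2 * K * m + 1) * z)"
  let ?\<mu> = "epi (of_int (k + n) - of_int K * of_int k ^ 2 * \<tau> - 2 * of_int K * of_int k * z)"
  have "?T m (z + of_int k * \<tau> + of_int n) = ?\<mu> * ?T (m + k) z" for m
    unfolding theta_coeff_conv_epi epi_add[symmetric]
    by (rule epi_eqI[of _ _ "K * m * n - k"]) (simp add: algebra_simps power2_eq_square)
  then have "theta K \<tau> (z + of_int k * \<tau> + of_int n) = (\<Sum>\<^sub>\<infinity>m. ?\<mu> * ?T (m + k) z)"
    unfolding theta_def by simp
  also have "\<dots> = ?\<mu> * (\<Sum>\<^sub>\<infinity>m. ?T (m + k) z)"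
    by (rule infsum_cmult_right')
  also have "(\<Sum>\<^sub>\<infinity>m. ?T (m + k) z) = theta K \<tau> z"
    unfolding theta_def
    by (rule infsum_reindex_bij_betw) (rule bij_betwI[of _ _ _ "\<lambda>m. m - k"], auto)
  finally show ?thesis .
qed

text \<open>Multiplication by \<open>epi (- x)\<close> makes all frequencies even, and the constant
  term comes from m = 0 alone. For the reflected series it would need Km = -1, which K \<ge> 2
  excludes; so symmetrising the series for K = 3 does not cancel this coefficient.\<close>

lemma theta_fourier:
  assumes "\<tau> \<in> upper_half_plane"
  shows "((\<lambda>x. epi (- of_real x) * theta K \<tau> (of_real x)) has_integral 1) {0..1}"
    and "K \<ge> 2 \<Longrightarrow> ((\<lambda>x. epi (- of_real x) * theta K \<tau> (- of_real x)) has_integral 0) {0..1}"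
proof -
  let ?a = "theta_coeff K (to_q \<tau>)"
  have a: "(\<lambda>m. norm (?a m)) summable_on UNIV"
    using theta_moment_summable[OF norm_to_q_less_1[OF assms], of 0] by simp
  have 1: "epi (- of_real x) * theta K \<tau> (of_real x) = (\<Sum>\<^sub>\<infinity>m. ?a m * epi (2 * of_int (K * m) * of_real x))" for x
    unfolding theta_def infsum_cmult_right'[symmetric]
  proof (rule infsum_cong)
    fix m
    have "epi (2 * of_int (K * m) * of_real x) = epi (- of_real x) * epi (of_int (2 * K * m + 1) * of_real x)"
      unfolding epi_add[symmetric] by (simp add: algebra_simps)
    then show "epi (- of_real x) * (?a m * epi (of_int (2 * K * m + 1) * of_real x)) =
        ?a m * epi (2 * of_int (K * m) * of_real x)"
      by simp
  qed
  have "(\<Sum>\<^sub>\<infinity>m. if K * m = 0 then ?a m else 0) = (\<Sum>\<^sub>\<infinity>m\<in>{0}. ?a m)"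
    using K by (intro infsum_cong_neutral) auto
  with fourier_series_integral[OF a, of "\<lambda>m. K * m"]
  show "((\<lambda>x. epi (- of_real x) * theta K \<tau> (of_real x)) has_integral 1) {0..1}"
    unfolding 1 by simp
  have 2: "epi (- of_real x) * theta K \<tau> (- of_real x) = (\<Sum>\<^sub>\<infinity>m. ?a m * epi (2 * of_int (- (K * m) - 1) * of_real x))" for x
    unfolding theta_def infsum_cmult_right'[symmetric]
  proof (rule infsum_cong)
    fix m
    have "epi (2 * of_int (- (K * m) - 1) * of_real x) = epi (- of_real x) * epi (of_int (2 * K * m + 1) * - of_real x)"
      unfolding epi_add[symmetric] by (rule arg_cong[of _ _ epi]) (simp add: algebra_simps)
    then show "epi (- of_real x) * (?a m * epi (of_int (2 * K * m + 1) * - of_real x)) =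
        ?a m * epi (2 * of_int (- (K * m) - 1) * of_real x)"
      by simp
  qed
  assume "K \<ge> 2"
  have "- (K * m) - 1 \<noteq> 0" for m
  proof
    assume "- (K * m) - 1 = 0"
    then have "K * (- m) = 1"
      by simp
    then show False
      using \<open>K \<ge> 2\<close> zmult_eq_1_iff[of K "- m"] by auto
  qed
  then show "((\<lambda>x. epi (- of_real x) * theta K \<tau> (- of_real x)) has_integral 0) {0..1}"
    using fourier_series_integral[OF a, of "\<lambda>m. - (K * m) - 1"] unfolding 2 by simp
qed

end

subsection \<open>Theta series in terms of the product\<close>

lemma odd_1_3: "odd (1 :: int)" "odd (3 :: int)"
  by auto

text \<open>The substitution of -1 - m for m fixes m(m + 1), negates 2m + 1 and changes the sign
  (-1)^m.\<close>

lemma theta_1_minus: "theta 1 \<tau> (- z) = - theta 1 \<tau> z"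
proof -
  let ?T = "\<lambda>m z. theta_coeff 1 (to_q \<tau>) m * epi (of_int (2 * 1 * m + 1) * z)"
  have "?T (- 1 - m) (- z) = - ?T m z" for m
  proof -
    have "?T (- 1 - m) (- z) = epi 1 * ?T m z"
      unfolding theta_coeff_conv_epi[OF order.refl odd_1_3(1)] epi_add[symmetric]
      by (rule epi_eqI[of _ _ "- 1 - m"]) (simp add: algebra_simps)
    then show ?thesis
      by (simp add: epi_1)
  qed
  then have "(\<Sum>\<^sub>\<infinity>m. ?T (- 1 - m) (- z)) = - theta 1 \<tau> z"
    unfolding theta_def infsum_uminus[symmetric] by simp
  moreover have "(\<Sum>\<^sub>\<infinity>m. ?T (- 1 - m) (- z)) = theta 1 \<tau> (- z)"
    unfolding theta_def
    by (rule infsum_reindex_bij_betw) (rule bij_betwI[of _ _ _ "\<lambda>m. - 1 - m"], auto)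
  ultimately show ?thesis
    by simp
qed

lemma theta_1_lattice: "theta 1 \<tau> (of_int k * \<tau> + of_int n) = 0"
  using theta_shift[OF order.refl odd_1_3(1), of \<tau> 0 k n] theta_1_minus[of \<tau> 0] by simp

text \<open>Symmetrising keeps the even Taylor coefficients, which are the ones in \<open>V\<close>.
  The result is the series side of the quintuple product identity.\<close>

definition theta_even :: "complex \<Rightarrow> complex \<Rightarrow> complex" where
  "theta_even \<tau> z = theta 3 \<tau> z + theta 3 \<tau> (- z)"

lemma theta_even_minus: "theta_even \<tau> (- z) = theta_even \<tau> z"
  by (simp add: theta_even_def)

lemma theta_even_shift:
  "theta_even \<tau> (z + of_int k * \<tau> + of_int n) =
     epi (of_int (k + n) - 3 * of_int k ^ 2 * \<tau> - 6 * of_int k * z) * theta_even \<tau> z"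
proof -
  have K: "(3 :: int) \<ge> 1"
    by simp
  have neg: "- (z + of_int k * \<tau> + of_int n) = - z + of_int (- k) * \<tau> + of_int (- n)"
    by simp
  have "epi (of_int (- k + - n) - of_int 3 * of_int (- k) ^ 2 * \<tau> - 2 * of_int 3 * of_int (- k) * - z) =
      epi (of_int (k + n) - 3 * of_int k ^ 2 * \<tau> - 6 * of_int k * z)"
    by (rule epi_eqI[of _ _ "- k - n"]) (simp add: algebra_simps)
  then show ?thesis
    unfolding theta_even_def neg theta_shift[OF K odd_1_3(2)] by (simp add: ring_distribs)
qed

context
  fixes \<tau> :: complex
  assumes \<tau>: "\<tau> \<in> upper_half_plane"
begin

text \<open>Jacobi's triple product identity with an unspecified constant, which is nonzero because
  the series has a Fourier coefficient 1.\<close>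

lemma theta_1_conv_lattice_prod:
  obtains c where "c \<noteq> 0" "\<And>z. theta 1 \<tau> z = c * lattice_prod \<tau> z"
proof -
  note shift = theta_shift[OF order.refl odd_1_3(1)]
  obtain c where c: "theta 1 \<tau> z = c * lattice_prod \<tau> z" for z
  proof (rule entire_multiple_of_lattice_prod[OF \<tau>])
    show "theta 1 \<tau> holomorphic_on UNIV"
      by (intro theta_entire \<tau>) auto
    show "theta 1 \<tau> (z + 2) = theta 1 \<tau> z" for z
      using shift[of \<tau> z 0 2] epi_even[of 1] by simp
    show "theta 1 \<tau> (z + 2 * \<tau>) = epi (- 4 * (\<tau> + z)) * theta 1 \<tau> z" for z
    proof -
      have "epi (of_int (2 + 0) - of_int 1 * of_int 2 ^ 2 * \<tau> - 2 * of_int 1 * of_int 2 * z) = epi (- 4 * (\<tau> + z))"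
        by (rule epi_eqI[of _ _ 1]) simp
      with shift[of \<tau> z 2 0] show ?thesis
        by simp
    qed
  qed (use theta_1_lattice that in auto)
  have "c \<noteq> 0"
  proof
    assume "c = 0"
    then have "((\<lambda>x. 0) has_integral (1 :: complex)) {0..1::real}"
      using theta_fourier(1)[OF order.refl odd_1_3(1) \<tau>] by (simp add: c)
    then show False
      using has_integral_unique[OF has_integral_0] by fastforce
  qed
  with c that show ?thesis
    by blast
qed

lemma theta_even_entire: "theta_even \<tau> holomorphic_on UNIV"
proof -
  have 3: "theta 3 \<tau> holomorphic_on UNIV"
    by (intro theta_entire \<tau>) auto
  have "(\<lambda>z. theta 3 \<tau> (- z)) holomorphic_on UNIV"
    using holomorphic_on_compose_gen[OF holomorphic_on_minus[OF holomorphic_on_ident] 3, of UNIV] by (simp add: o_def)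
  with 3 show ?thesis
    unfolding theta_even_def[abs_def] by (intro holomorphic_intros)
qed

text \<open>If 2w = k\<tau> + n then w = -w + k\<tau> + n, so evenness and the shift formula
  multiply the value at w by (-1)^(k + n + 3kn). This exponent is odd unless k and n are both
  even.\<close>

lemma theta_even_half_lattice:
  assumes "odd k \<or> odd n"
  shows "theta_even \<tau> ((of_int k * \<tau> + of_int n) / 2) = 0"
proof -
  let ?w = "(of_int k * \<tau> + of_int n) / 2"
  have "theta_even \<tau> ?w = theta_even \<tau> (- ?w + of_int k * \<tau> + of_int n)"
    by (rule arg_cong[of _ _ "theta_even \<tau>"]) (simp add: field_simps)
  also have "\<dots> = epi (of_int (k + n) - 3 * of_int k ^ 2 * \<tau> - 6 * of_int k * - ?w) * theta_even \<tau> ?w"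
    unfolding theta_even_shift theta_even_minus ..
  also have "epi (of_int (k + n) - 3 * of_int k ^ 2 * \<tau> - 6 * of_int k * - ?w) = epi (of_int (k + n + 3 * k * n))"
    by (rule arg_cong[of _ _ epi]) (simp add: field_simps power2_eq_square)
  also have "\<dots> = - 1"
  proof -
    have "odd (k + n + 3 * k * n)"
      using assms by auto
    then show ?thesis
      unfolding epi_of_int by simp
  qed
  finally show ?thesis
    by simp
qed

text \<open>The quintuple product identity with an unspecified constant. As a function of w = 2z the
  left side vanishes on the lattice: w/2 is either a lattice point, where
  \<open>lattice_prod\<close> vanishes, or a half period, where \<open>theta_even\<close>
  does.\<close>

lemma theta_even_conv_lattice_prod:
  obtains c where "c \<noteq> 0" "\<And>z. theta_even \<tau> z * lattice_prod \<tau> z = c * lattice_prod \<tau> (2 * z)"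
proof -
  have half: "(\<lambda>w. f (w / 2)) holomorphic_on UNIV" if "f holomorphic_on UNIV" for f :: "complex \<Rightarrow> complex"
  proof -
    have "(\<lambda>w. w / 2) holomorphic_on (UNIV :: complex set)"
      by (intro holomorphic_intros) auto
    from holomorphic_on_compose_gen[OF this that] show ?thesis
      by (simp add: o_def)
  qed
  obtain c where c: "theta_even \<tau> (w / 2) * lattice_prod \<tau> (w / 2) = c * lattice_prod \<tau> w" for w
  proof (rule entire_multiple_of_lattice_prod[OF \<tau>])
    show "(\<lambda>w. theta_even \<tau> (w / 2) * lattice_prod \<tau> (w / 2)) holomorphic_on UNIV"
      by (intro holomorphic_on_mult half theta_even_entire lattice_prod_entire \<tau>)
    show "theta_even \<tau> ((of_int k * \<tau> + of_int n) / 2) * lattice_prod \<tau> ((of_int k * \<tau> + of_int n) / 2) = 0" for k n :: int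
    proof (cases "odd k \<or> odd n")
      case False
      then obtain k' n' where "k = 2 * k'" "n = 2 * n'"
        by (auto elim!: evenE)
      then show ?thesis
        using lattice_prod_simple_zero(1)[OF \<tau>, of k' n'] by (simp add: add_divide_distrib)
    qed (simp add: theta_even_half_lattice)
    show "theta_even \<tau> ((w + 2) / 2) * lattice_prod \<tau> ((w + 2) / 2) =
        theta_even \<tau> (w / 2) * lattice_prod \<tau> (w / 2)" for w
      using theta_even_shift[of \<tau> "w / 2" 0 1] lattice_prod_plus_1[OF \<tau>, of "w / 2"]
      by (simp add: add_divide_distrib epi_1)
    show "theta_even \<tau> ((w + 2 * \<tau>) / 2) * lattice_prod \<tau> ((w + 2 * \<tau>) / 2) =
        epi (- 4 * (\<tau> + w)) * (theta_even \<tau> (w / 2) * lattice_prod \<tau> (w / 2))" for w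
    proof -
      have "theta_even \<tau> (w / 2 + \<tau>) = epi (1 - 3 * \<tau> - 3 * w) * theta_even \<tau> (w / 2)"
        using theta_even_shift[of \<tau> "w / 2" 1 0] by simp
      moreover have "lattice_prod \<tau> (w / 2 + \<tau>) = epi (1 + (- \<tau> - w)) * lattice_prod \<tau> (w / 2)"
        using lattice_prod_plus_tau[OF \<tau>, of "w / 2"] epi_add[of 1 "- \<tau> - w"] by (simp add: epi_1)
      moreover have "epi (1 - 3 * \<tau> - 3 * w) * epi (1 + (- \<tau> - w)) = epi (- 4 * (\<tau> + w))"
        unfolding epi_add[symmetric] by (rule epi_eqI[of _ _ 1]) simp
      ultimately show ?thesis
        by (simp add: add_divide_distrib)
    qed
  qed (use that in auto)
  have c': "theta_even \<tau> z * lattice_prod \<tau> z = c * lattice_prod \<tau> (2 * z)" for z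
    using c[of "2 * z"] by simp
  have "c \<noteq> 0"
  proof
    assume "c = 0"
    then have "theta_even \<tau> z = 0" for z
      using eq_0_if_mult_simple_zeros_eq_0[OF theta_even_entire lattice_prod_entire[OF \<tau>]
          deriv_lattice_prod_nonzero[OF \<tau>]] c' by (simp add: mult.commute)
    moreover have "((\<lambda>x. epi (- of_real x) * theta_even \<tau> (of_real x)) has_integral 1 + 0) {0..1}"
      unfolding theta_even_def distrib_left
      by (intro has_integral_add theta_fourier \<tau>) auto
    ultimately have "((\<lambda>x. 0) has_integral (1 :: complex)) {0..1::real}"
      by simp
    then show False
      using has_integral_unique[OF has_integral_0] by fastforce
  qed
  with c' that show ?thesis
    by blast
qed

text \<open>The derivative of \<open>theta 1 \<tau>\<close> at 0 is \<pi>i times this moment, and it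
  is a nonzero multiple of that of \<open>lattice_prod \<tau>\<close>.\<close>

lemma theta_moment_1_nonzero: "theta_moment 1 1 (to_q \<tau>) \<noteq> 0"
proof -
  obtain c where c: "c \<noteq> 0" "\<And>z. theta 1 \<tau> z = c * lattice_prod \<tau> z"
    using theta_1_conv_lattice_prod by blast
  have "theta 1 \<tau> = (\<lambda>z. c * lattice_prod \<tau> z)"
    using c(2) by (simp add: fun_eq_iff)
  moreover have "((\<lambda>z. c * lattice_prod \<tau> z) has_field_derivative c * deriv (lattice_prod \<tau>) 0) (at 0)"
    by (intro DERIV_cmult holomorphic_derivI[OF lattice_prod_entire[OF \<tau>]]) auto
  ultimately have "deriv (theta 1 \<tau>) 0 = c * deriv (lattice_prod \<tau>) 0"
    by (simp add: DERIV_imp_deriv)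
  moreover have "theta 1 \<tau> has_fps_expansion Abs_fps (\<lambda>k. (of_real pi * \<i>) ^ k * theta_moment 1 k (to_q \<tau>) / fact k)"
    by (intro theta_has_fps_expansion \<tau>) auto
  from fps_nth_fps_expansion[OF this, of 1] have "deriv (theta 1 \<tau>) 0 = of_real pi * \<i> * theta_moment 1 1 (to_q \<tau>)"
    by simp
  ultimately show ?thesis
    using c(1) deriv_lattice_prod_0[OF \<tau>] by auto
qed

text \<open>Differentiating the product identity at z = 0, where \<open>lattice_prod\<close>
  vanishes, gives \<open>theta_even \<tau> 0 = 2 * c\<close>.\<close>

lemma theta_moment_3_nonzero: "theta_moment 3 0 (to_q \<tau>) \<noteq> 0"
proof -
  obtain c where c: "c \<noteq> 0" "\<And>z. theta_even \<tau> z * lattice_prod \<tau> z = c * lattice_prod \<tau> (2 * z)"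
    using theta_even_conv_lattice_prod by blast
  let ?P' = "deriv (lattice_prod \<tau>) 0"
  have P: "(lattice_prod \<tau> has_field_derivative ?P') (at 0)"
    by (rule holomorphic_derivI[OF lattice_prod_entire[OF \<tau>]]) auto
  have "((\<lambda>z. theta_even \<tau> z * lattice_prod \<tau> z) has_field_derivative theta_even \<tau> 0 * ?P' + deriv (theta_even \<tau>) 0 * lattice_prod \<tau> 0) (at 0)"
    by (rule DERIV_mult'[OF holomorphic_derivI[OF theta_even_entire] P]) auto
  moreover have "((\<lambda>z. lattice_prod \<tau> (2 * z)) has_field_derivative ?P' * 2) (at 0)"
    by (rule DERIV_chain2[where f = "lattice_prod \<tau>"]) (auto intro!: derivative_eq_intros P)
  then have "((\<lambda>z. c * lattice_prod \<tau> (2 * z)) has_field_derivative c * (?P' * 2)) (at 0)"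
    by (rule DERIV_cmult)
  ultimately have "theta_even \<tau> 0 * ?P' = c * (?P' * 2)"
    using DERIV_unique by (fastforce simp: c(2) lattice_prod_0[OF \<tau>])
  then have "theta_even \<tau> 0 \<noteq> 0"
    using c(1) deriv_lattice_prod_0[OF \<tau>] by auto
  moreover have "theta 3 \<tau> 0 = theta_moment 3 0 (to_q \<tau>)"
    by (simp add: theta_def theta_moment_def)
  ultimately show ?thesis
    by (simp add: theta_even_def)
qed

end

subsection \<open>Modular transformations\<close>

definition moebius_action :: "int \<Rightarrow> int \<Rightarrow> int \<Rightarrow> int \<Rightarrow> complex \<Rightarrow> complex" where
  "moebius_action a b c d \<tau> = (of_int a * \<tau> + of_int b) / (of_int c * \<tau> + of_int d)"

context
  fixes a b c d :: int and \<tau> J \<tau>' :: complex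
  assumes det: "a * d - b * c = 1" and \<tau>: "\<tau> \<in> upper_half_plane"
  defines "J \<equiv> of_int c * \<tau> + of_int d" and "\<tau>' \<equiv> moebius_action a b c d \<tau>"
begin

lemma det': "of_int a * of_int d - of_int b * of_int c = (1 :: 'a :: ring_1)"
  using arg_cong[OF det, of "of_int :: int \<Rightarrow> 'a"] by simp

lemma automorphy_nonzero: "J \<noteq> 0"
proof
  assume J: "J = 0"
  then have "of_int c * Im \<tau> = 0"
    by (simp add: J_def complex_eq_iff)
  then have "c = 0"
    using \<tau> by (simp add: upper_half_plane_def)
  with J have "d = 0"
    by (simp add: J_def)
  with \<open>c = 0\<close> det show False
    by simp
qed

lemma Im_moebius: "Im \<tau>' = Im \<tau> / norm J ^ 2"
proof -
  have J2: "norm J ^ 2 = (of_int c * Re \<tau> + of_int d) ^ 2 + (of_int c * Im \<tau>) ^ 2"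
    by (simp add: cmod_power2 J_def)
  have "Im \<tau>' = (of_int a * of_int d - of_int b * of_int c) * Im \<tau> / norm J ^ 2"
    unfolding J2 by (simp add: \<tau>'_def moebius_action_def Im_divide field_simps)
  then show ?thesis
    by (simp add: det')
qed

lemma moebius_in_upper_half_plane: "\<tau>' \<in> upper_half_plane"
  using \<tau> automorphy_nonzero by (simp add: upper_half_plane_def Im_moebius)

text \<open>This formula and the one for \<tau> / J come from the inverse matrix. They show that
  division by \<open>J\<close> maps the lattice of \<tau> into that of \<tau>'.\<close>

lemma inverse_automorphy: "1 / J = of_int a - of_int c * \<tau>'"
proof -
  have "of_int a * J - of_int c * (of_int a * \<tau> + of_int b) = 1"
    using det'[where 'a = complex] by (simp add: J_def algebra_simps)
  then have "(of_int a - of_int c * \<tau>') * J = 1"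
    using automorphy_nonzero unfolding \<tau>'_def moebius_action_def by (simp add: J_def[symmetric] left_diff_distrib)
  then show ?thesis
    using automorphy_nonzero by (simp add: divide_eq_eq)
qed

lemma tau_over_automorphy: "\<tau> / J = of_int d * \<tau>' - of_int b"
proof -
  have "of_int d * (of_int a * \<tau> + of_int b) - of_int b * J = \<tau> * (of_int a * of_int d - of_int b * of_int c)"
    by (simp add: J_def algebra_simps)
  then have "(of_int d * \<tau>' - of_int b) * J = \<tau>"
    using automorphy_nonzero unfolding \<tau>'_def moebius_action_def by (simp add: J_def[symmetric] left_diff_distrib det')
  then show ?thesis
    using automorphy_nonzero by (simp add: divide_eq_eq)
qed

text \<open>The function \<open>g\<close>, which is \<open>theta 1 \<tau>'\<close> at z / J times a
  Gaussian that corrects the multipliers, meets the hypotheses of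
  \<open>entire_multiple_of_lattice_prod\<close> for \<tau>. The series is used instead of the
  product because \<open>theta_shift\<close> handles all lattice shifts at once.\<close>

lemma lattice_prod_moebius:
  obtains \<kappa> where "\<kappa> \<noteq> 0" "\<And>z. lattice_prod \<tau>' (z / J) = \<kappa> * epi (of_int c * z ^ 2 / J) * lattice_prod \<tau> z"
proof -
  note shift = theta_shift[OF order.refl odd_1_3(1)]
  define w where "w = 1 / J"
  have wJ: "w * (of_int c * \<tau> + of_int d) = 1"
    using automorphy_nonzero by (simp add: w_def J_def)
  have w: "w = of_int a - of_int c * \<tau>'"
    unfolding w_def by (rule inverse_automorphy)
  have tw: "\<tau> * w = of_int d * \<tau>' - of_int b"
    using tau_over_automorphy by (simp add: w_def)
  define g where "g z = epi (- (of_int c * z ^ 2 * w)) * theta 1 \<tau>' (z * w)" for z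
  obtain c1 where c1: "g z = c1 * lattice_prod \<tau> z" for z
  proof (rule entire_multiple_of_lattice_prod[OF \<tau>])
    have "theta 1 \<tau>' holomorphic_on UNIV"
      by (intro theta_entire moebius_in_upper_half_plane) auto
    moreover have "(\<lambda>z. z * w) holomorphic_on UNIV"
      by (intro holomorphic_intros)
    ultimately have "(\<lambda>z. theta 1 \<tau>' (z * w)) holomorphic_on UNIV"
      using holomorphic_on_compose_gen[of "\<lambda>z. z * w" UNIV "theta 1 \<tau>'" UNIV] by (simp add: o_def)
    then show "g holomorphic_on UNIV"
      unfolding g_def[abs_def] by (intro holomorphic_intros)
    show "g (of_int k * \<tau> + of_int n) = 0" for k n
    proof -
      have "(of_int k * \<tau> + of_int n) * w = of_int (k * d - n * c) * \<tau>' + of_int (n * a - k * b)"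
      proof -
        have "(of_int k * \<tau> + of_int n) * w = of_int k * (\<tau> * w) + of_int n * w"
          by (simp add: algebra_simps)
        also have "\<dots> = of_int k * (of_int d * \<tau>' - of_int b) + of_int n * (of_int a - of_int c * \<tau>')"
          by (simp only: tw w[symmetric])
        finally show ?thesis
          by (simp add: algebra_simps)
      qed
      then show ?thesis
        by (simp add: g_def theta_1_lattice del: of_int_diff of_int_mult)
    qed
    show "g (z + 2) = g z" for z
    proof -
      have "(z + 2) * w = z * w + of_int (- 2 * c) * \<tau>' + of_int (2 * a)"
        by (simp add: w algebra_simps)
      then have "g (z + 2) = epi (- (of_int c * (z + 2) ^ 2 * w) +
          (of_int (- 2 * c + 2 * a) - of_int 1 * of_int (- 2 * c) ^ 2 * \<tau>' - 2 * of_int 1 * of_int (- 2 * c) * (z * w))) *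
          theta 1 \<tau>' (z * w)"
        unfolding g_def by (simp only: shift epi_add mult.assoc)
      also have "epi (- (of_int c * (z + 2) ^ 2 * w) +
          (of_int (- 2 * c + 2 * a) - of_int 1 * of_int (- 2 * c) ^ 2 * \<tau>' - 2 * of_int 1 * of_int (- 2 * c) * (z * w))) =
          epi (- (of_int c * z ^ 2 * w))"
      \<comment> \<open>The terms linear in z cancel, and w = a - c\<tau>' reduces the remainder to
        twice this integer.\<close>
      proof (rule epi_eqI[of _ _ "a - c - 2 * a * c"])
        show "- (of_int c * (z + 2) ^ 2 * w) +
          (of_int (- 2 * c + 2 * a) - of_int 1 * of_int (- 2 * c) ^ 2 * \<tau>' - 2 * of_int 1 * of_int (- 2 * c) * (z * w)) =
          - (of_int c * z ^ 2 * w) + 2 * of_int (a - c - 2 * a * c)"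
          by (simp add: w algebra_simps power2_eq_square)
      qed
      finally show ?thesis
        by (simp add: g_def)
    qed
    show "g (z + 2 * \<tau>) = epi (- 4 * (\<tau> + z)) * g z" for z
    proof -
      have "(z + 2 * \<tau>) * w = z * w + of_int (2 * d) * \<tau>' + of_int (- 2 * b)"
      proof -
        have "(z + 2 * \<tau>) * w = z * w + 2 * (\<tau> * w)"
          by (simp add: algebra_simps)
        then show ?thesis
          unfolding tw by (simp add: algebra_simps)
      qed
      then have "g (z + 2 * \<tau>) = epi (- (of_int c * (z + 2 * \<tau>) ^ 2 * w) +
          (of_int (2 * d + - 2 * b) - of_int 1 * of_int (2 * d) ^ 2 * \<tau>' - 2 * of_int 1 * of_int (2 * d) * (z * w))) *
          theta 1 \<tau>' (z * w)"
        unfolding g_def by (simp only: shift epi_add mult.assoc)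
      also have "epi (- (of_int c * (z + 2 * \<tau>) ^ 2 * w) +
          (of_int (2 * d + - 2 * b) - of_int 1 * of_int (2 * d) ^ 2 * \<tau>' - 2 * of_int 1 * of_int (2 * d) * (z * w))) =
          epi (- 4 * (\<tau> + z) + - (of_int c * z ^ 2 * w))"
      proof (rule epi_eqI[of _ _ "d - b - 2 * b * d"])
        have 1: "z * (of_int c * \<tau> * w + of_int d * w) = z"
          using wJ by (simp add: algebra_simps)
        have "of_int c * \<tau> * (\<tau> * w) + of_int d ^ 2 * \<tau>' =
            \<tau> * (w * (of_int c * \<tau> + of_int d)) + of_int d * (of_int d * \<tau>' - \<tau> * w)"
          by (simp add: algebra_simps power2_eq_square)
        also have "\<dots> = \<tau> + of_int d * of_int b"
          unfolding wJ tw by simp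
        finally have 2: "of_int c * \<tau> * (\<tau> * w) + of_int d ^ 2 * \<tau>' = \<tau> + of_int d * of_int b" .
        \<comment> \<open>The exponent is grouped so that \<open>1\<close> evaluates the part linear
          in z and \<open>2\<close> the part free of z.\<close>
        have "- (of_int c * (z + 2 * \<tau>) ^ 2 * w) +
          (of_int (2 * d + - 2 * b) - of_int 1 * of_int (2 * d) ^ 2 * \<tau>' - 2 * of_int 1 * of_int (2 * d) * (z * w)) =
          - (of_int c * z ^ 2 * w) - 4 * (z * (of_int c * \<tau> * w + of_int d * w)) -
          4 * (of_int c * \<tau> * (\<tau> * w) + of_int d ^ 2 * \<tau>') + 2 * of_int (d - b)"
          by (simp add: algebra_simps power2_eq_square)
        also have "\<dots> = - 4 * (\<tau> + z) + - (of_int c * z ^ 2 * w) + 2 * of_int (d - b - 2 * b * d)"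
          unfolding 1 2 by (simp add: algebra_simps)
        finally show "- (of_int c * (z + 2 * \<tau>) ^ 2 * w) +
          (of_int (2 * d + - 2 * b) - of_int 1 * of_int (2 * d) ^ 2 * \<tau>' - 2 * of_int 1 * of_int (2 * d) * (z * w)) =
          - 4 * (\<tau> + z) + - (of_int c * z ^ 2 * w) + 2 * of_int (d - b - 2 * b * d)" .
      qed
      finally show ?thesis
        by (simp only: g_def epi_add mult.assoc)
    qed
  qed (use that in auto)
  obtain c0 where c0: "c0 \<noteq> 0" "\<And>z. theta 1 \<tau>' z = c0 * lattice_prod \<tau>' z"
    using theta_1_conv_lattice_prod[OF moebius_in_upper_half_plane] by blast
  have eq: "lattice_prod \<tau>' (z / J) = c1 / c0 * epi (of_int c * z ^ 2 / J) * lattice_prod \<tau> z" for z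
  proof -
    have "epi (of_int c * z ^ 2 * w) * g z = theta 1 \<tau>' (z * w)"
      using epi_add[of "of_int c * z ^ 2 * w" "- (of_int c * z ^ 2 * w)"] by (simp add: g_def)
    then show ?thesis
      using c0(1) by (simp add: c0(2) c1 w_def field_simps)
  qed
  moreover have "c1 / c0 \<noteq> 0"
  proof
    assume "c1 / c0 = 0"
    then have "lattice_prod \<tau>' z = 0" for z
      using eq[of "z * J"] automorphy_nonzero by auto
    then have "lattice_prod \<tau>' = (\<lambda>_. 0)"
      by (simp add: fun_eq_iff)
    then have "deriv (lattice_prod \<tau>') 0 = 0"
      by simp
    then show False
      using deriv_lattice_prod_0[OF moebius_in_upper_half_plane] by simp
  qed
  ultimately show ?thesis
    using that by blast
qed

lemma theta_1_moebius:
  obtains \<kappa> where "\<And>z. theta 1 \<tau>' (z / J) = \<kappa> * epi (1 * of_int c * z ^ 2 / J) * theta 1 \<tau> z"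
proof -
  obtain \<kappa> where \<kappa>: "\<And>z. lattice_prod \<tau>' (z / J) = \<kappa> * epi (of_int c * z ^ 2 / J) * lattice_prod \<tau> z"
    using lattice_prod_moebius by blast
  obtain c0 where c0: "c0 \<noteq> 0" "\<And>z. theta 1 \<tau> z = c0 * lattice_prod \<tau> z"
    using theta_1_conv_lattice_prod[OF \<tau>] by blast
  obtain c0' where c0': "\<And>z. theta 1 \<tau>' z = c0' * lattice_prod \<tau>' z"
    using theta_1_conv_lattice_prod[OF moebius_in_upper_half_plane] by blast
  show ?thesis
    by (rule that[of "c0' * \<kappa> / c0"]) (use c0(1) in \<open>simp add: c0(2) c0' \<kappa>\<close>)
qed

text \<open>Since \<open>theta_even\<close> is a quotient of \<open>lattice_prod\<close> at 2z and
  at z, its Gaussian factor has coefficient 4c - c = 3c. Division by \<open>lattice_prod\<close> is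
  avoided by showing that its product with the difference \<open>D\<close> of both sides is
  0.\<close>

lemma theta_even_moebius:
  obtains \<kappa> where "\<And>z. theta_even \<tau>' (z / J) = \<kappa> * epi (3 * of_int c * z ^ 2 / J) * theta_even \<tau> z"
proof -
  obtain \<kappa> where \<kappa>: "\<kappa> \<noteq> 0" "\<And>z. lattice_prod \<tau>' (z / J) = \<kappa> * epi (of_int c * z ^ 2 / J) * lattice_prod \<tau> z"
    using lattice_prod_moebius by blast
  obtain c0 where c0: "c0 \<noteq> 0" "\<And>z. theta_even \<tau> z * lattice_prod \<tau> z = c0 * lattice_prod \<tau> (2 * z)"
    using theta_even_conv_lattice_prod[OF \<tau>] by blast
  obtain c0' where c0': "\<And>z. theta_even \<tau>' z * lattice_prod \<tau>' z = c0' * lattice_prod \<tau>' (2 * z)"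
    using theta_even_conv_lattice_prod[OF moebius_in_upper_half_plane] by blast
  define D where "D z = theta_even \<tau>' (z / J) - c0' / c0 * epi (3 * of_int c * z ^ 2 / J) * theta_even \<tau> z" for z
  have "(\<lambda>z. z / J) holomorphic_on UNIV"
    by (intro holomorphic_intros automorphy_nonzero)
  then have "(\<lambda>z. theta_even \<tau>' (z / J)) holomorphic_on UNIV"
    using holomorphic_on_compose_gen[OF _ theta_even_entire[OF moebius_in_upper_half_plane]] by (auto simp: o_def)
  then have D: "D holomorphic_on UNIV"
    unfolding D_def[abs_def] by (intro holomorphic_intros theta_even_entire \<tau> automorphy_nonzero)
  have "lattice_prod \<tau> z * D z = 0" for z
  proof -
    let ?e = "epi (of_int c * z ^ 2 / J)"
    have e4: "epi (of_int c * (2 * z) ^ 2 / J) = ?e * epi (3 * of_int c * z ^ 2 / J)"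
      unfolding epi_add[symmetric] by (rule arg_cong[of _ _ epi]) (simp add: power_mult_distrib add_divide_distrib[symmetric])
    have "theta_even \<tau>' (z / J) * (\<kappa> * ?e * lattice_prod \<tau> z) = c0' * lattice_prod \<tau>' (2 * z / J)"
      using c0'[of "z / J"] by (simp add: \<kappa>(2))
    also have "\<dots> = c0' / c0 * \<kappa> * ?e * epi (3 * of_int c * z ^ 2 / J) * (c0 * lattice_prod \<tau> (2 * z))"
      unfolding \<kappa>(2) e4 using c0(1) by simp
    also have "\<dots> = c0' / c0 * \<kappa> * ?e * epi (3 * of_int c * z ^ 2 / J) * (theta_even \<tau> z * lattice_prod \<tau> z)"
      by (simp only: c0(2))
    finally have "(\<kappa> * ?e) * (lattice_prod \<tau> z * D z) = 0"
      by (simp add: D_def algebra_simps)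
    then show ?thesis
      using \<kappa>(1) by simp
  qed
  then have "D z = 0" for z
    using eq_0_if_mult_simple_zeros_eq_0[OF D lattice_prod_entire[OF \<tau>] deriv_lattice_prod_nonzero[OF \<tau>]]
    by simp
  then show ?thesis
    by (intro that[of "c0' / c0"]) (simp add: D_def)
qed

text \<open>Here 1 / Im \<tau>' = J cnj J / v and cnj J = J - 2icv. The second summand produces
  exactly the exponential that cancels the multiplier of the theta function when s =
  K\<pi>/2.\<close>

lemma gaussian_moebius:
  "exp (s / of_real (Im \<tau>') * (z / J) ^ 2) * exp (2 * \<i> * s * of_int c * z ^ 2 / J) = exp (s / of_real (Im \<tau>) * z ^ 2)"
proof -
  define v where "v = Im \<tau>"
  have v: "v > 0"
    using \<tau> by (simp add: v_def upper_half_plane_def)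
  have "J - cnj J = 2 * \<i> * of_int c * of_real v"
    by (simp add: J_def v_def complex_eq_iff)
  then have cnj: "cnj J = J - 2 * \<i> * of_int c * of_real v"
    by (simp add: algebra_simps)
  have "1 / of_real (Im \<tau>') = J * cnj J / of_real v"
    using v automorphy_nonzero by (simp add: Im_moebius v_def complex_norm_square[symmetric])
  then have "s / of_real (Im \<tau>') * (z / J) ^ 2 = s * (J * cnj J / of_real v) * (z / J) ^ 2"
    by (metis times_divide_eq_right mult.right_neutral)
  also have "\<dots> = s * z ^ 2 * (J - 2 * \<i> * of_int c * of_real v) / (J * of_real v)"
    using automorphy_nonzero v unfolding cnj by (simp add: field_simps power2_eq_square)
  also have "\<dots> + 2 * \<i> * s * of_int c * z ^ 2 / J = s / of_real v * z ^ 2"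
    using automorphy_nonzero v by (simp add: field_simps)
  finally show ?thesis
    by (simp add: exp_add[symmetric] v_def)
qed

end

subsection \<open>Taylor coefficients of Gaussian twists\<close>

definition gaussian_fps :: "complex \<Rightarrow> complex fps" where
  "gaussian_fps s = Abs_fps (\<lambda>k. if even k then s ^ (k div 2) / fact (k div 2) else 0)"

lemma gaussian_has_fps_expansion: "(\<lambda>z. exp (s * z ^ 2)) has_fps_expansion gaussian_fps s"
proof (rule has_fps_expansionI[OF always_eventually], rule allI)
  fix z :: complex
  have "(\<lambda>j. (s * z ^ 2) ^ j / fact j) sums exp (s * z ^ 2)"
    using exp_has_sum by (rule has_sum_imp_sums)
  then have "(\<lambda>j. (\<lambda>k. fps_nth (gaussian_fps s) k * z ^ k) (2 * j)) sums exp (s * z ^ 2)"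
    by (simp add: gaussian_fps_def power_mult_distrib power_mult)
  then show "(\<lambda>k. fps_nth (gaussian_fps s) k * z ^ k) sums exp (s * z ^ 2)"
    by (subst (asm) sums_mono_reindex) (auto simp: gaussian_fps_def strict_mono_def elim!: evenE)
qed

lemma gaussian_fps_mult_nth:
  "fps_nth (gaussian_fps s * F) N = (\<Sum>j\<le>N div 2. s ^ j / fact j * fps_nth F (N - 2 * j))"
proof -
  have "fps_nth (gaussian_fps s * F) N = (\<Sum>i=0..N. fps_nth (gaussian_fps s) i * fps_nth F (N - i))"
    by (rule fps_mult_nth)
  also have "\<dots> = (\<Sum>i\<in>(\<lambda>j. 2 * j) ` {..N div 2}. fps_nth (gaussian_fps s) i * fps_nth F (N - i))"
    by (rule sum.mono_neutral_right) (auto simp: gaussian_fps_def elim!: evenE)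
  also have "\<dots> = (\<Sum>j\<le>N div 2. s ^ j / fact j * fps_nth F (N - 2 * j))"
    by (subst sum.reindex) (auto simp: inj_on_def gaussian_fps_def)
  finally show ?thesis .
qed

lemma has_fps_expansion_scale:
  fixes f :: "complex \<Rightarrow> complex"
  assumes "f has_fps_expansion F"
  shows "(\<lambda>z. f (w * z)) has_fps_expansion Abs_fps (\<lambda>k. w ^ k * fps_nth F k)"
proof -
  have "(\<lambda>z. w * z) has_fps_expansion fps_const w * fps_X"
    by (intro fps_expansion_intros)
  from has_fps_expansion_compose[OF assms this] show ?thesis
    by (simp add: o_def fps_compose_linear)
qed

text \<open>The Gaussian twists of \<open>X\<close> and \<open>Y\<close> differ only by the factor
  \<kappa> and the scaling of z by 1/J. Comparing coefficients of z^N turns the scaling into a power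
  of the automorphy factor.\<close>

lemma gaussian_twist_coeff_moebius:
  fixes K :: nat
  assumes det: "a * d - b * c = 1" and \<tau>: "\<tau> \<in> upper_half_plane"
    and X: "X has_fps_expansion FX" and Y: "Y has_fps_expansion FY"
    and XY: "\<And>z. X (z / (of_int c * \<tau> + of_int d)) =
               \<kappa> * epi (of_nat K * of_int c * z ^ 2 / (of_int c * \<tau> + of_int d)) * Y z"
  shows "(1 / (of_int c * \<tau> + of_int d)) ^ N *
           fps_nth (gaussian_fps (of_nat K * of_real pi / 2 / of_real (Im (moebius_action a b c d \<tau>))) * FX) N =
         \<kappa> * fps_nth (gaussian_fps (of_nat K * of_real pi / 2 / of_real (Im \<tau>)) * FY) N"
proof -
  define J where "J = of_int c * \<tau> + of_int d"
  define s :: complex where "s = of_nat K * of_real pi / 2"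
  let ?s' = "s / of_real (Im (moebius_action a b c d \<tau>))" and ?s = "s / of_real (Im \<tau>)"
  have J: "J \<noteq> 0"
    unfolding J_def by (rule automorphy_nonzero[OF det \<tau>])
  have "exp (?s' * (1 / J * z) ^ 2) * X (1 / J * z) = \<kappa> * (exp (?s * z ^ 2) * Y z)" for z
  proof -
    have "epi (of_nat K * of_int c * z ^ 2 / J) = exp (2 * \<i> * s * of_int c * z ^ 2 / J)"
      by (simp add: epi_def s_def mult_ac)
    then show ?thesis
      using gaussian_moebius[OF det \<tau>, of s z, folded J_def] XY[of z, folded J_def] by (simp add: mult_ac)
  qed
  moreover have "(\<lambda>z. exp (?s' * (1 / J * z) ^ 2) * X (1 / J * z)) has_fps_expansion
      Abs_fps (\<lambda>k. (1 / J) ^ k * fps_nth (gaussian_fps ?s' * FX) k)"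
    by (rule has_fps_expansion_scale[where f = "\<lambda>z. exp (?s' * z ^ 2) * X z"])
       (intro has_fps_expansion_mult gaussian_has_fps_expansion X)
  moreover have "(\<lambda>z. \<kappa> * (exp (?s * z ^ 2) * Y z)) has_fps_expansion
      fps_const \<kappa> * (gaussian_fps ?s * FY)"
    by (intro has_fps_expansion_mult has_fps_expansion_const gaussian_has_fps_expansion Y)
  ultimately have "Abs_fps (\<lambda>k. (1 / J) ^ k * fps_nth (gaussian_fps ?s' * FX) k) =
      fps_const \<kappa> * (gaussian_fps ?s * FY)"
    by (auto intro: fps_expansion_unique_complex)
  from arg_cong[OF this, of "\<lambda>F. fps_nth F N"] show ?thesis
    by (simp add: J_def s_def)
qed

section \<open>The functions \<open>U\<close> and \<open>V\<close> as quotients of moments\<close>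

lemma infsum_int_symmetric:
  fixes f :: "int \<Rightarrow> complex"
  assumes "(\<lambda>m. norm (f m)) summable_on UNIV" and sym: "\<And>m. f (- 1 - m) = f m"
  shows "infsum f UNIV = 2 * (\<Sum>m. f (int m))"
proof -
  have f: "f summable_on UNIV"
    using assms(1) by (rule abs_summable_summable)
  have nat: "(\<lambda>m. f (int m)) summable_on UNIV"
    using summable_on_subset[OF f, of "range int"] by (simp add: summable_on_reindex o_def)
  have "infsum f (range int \<union> range (\<lambda>m. - 1 - int m)) = infsum f (range int) + infsum f (range (\<lambda>m. - 1 - int m))"
    by (rule infsum_Un_disjoint) (auto intro: summable_on_subset[OF f])
  also have "range int \<union> range (\<lambda>m. - 1 - int m) = UNIV"
  proof (intro equalityI subsetI UNIV_I)
    fix m :: int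
    show "m \<in> range int \<union> range (\<lambda>m. - 1 - int m)"
    proof (cases "m \<ge> 0")
      case True
      then show ?thesis
        by (auto intro!: image_eqI[of _ _ "nat m"])
    next
      case False
      then show ?thesis
        by (auto intro!: image_eqI[of _ _ "nat (- 1 - m)"])
    qed
  qed
  also have "infsum f (range int) = (\<Sum>\<^sub>\<infinity>m. f (int m))"
    by (subst infsum_reindex) (auto simp: o_def)
  also have "infsum f (range (\<lambda>m. - 1 - int m)) = (\<Sum>\<^sub>\<infinity>m. f (int m))"
    by (subst infsum_reindex) (auto simp: o_def inj_on_def sym)
  also have "(\<Sum>\<^sub>\<infinity>m. f (int m)) = (\<Sum>m. f (int m))"
    using has_sum_imp_sums[OF has_sum_infsum[OF nat]] by (rule sums_unique)
  finally show ?thesis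
    by simp
qed

text \<open>Replacing m by -1 - m changes the sign of (-1)^m and of the odd power and fixes the
  exponent of q. So the negative indices repeat the sum over the natural numbers in
  \<open>U\<close>.\<close>

lemma theta_moment_1_odd:
  assumes "norm q < 1"
  shows "theta_moment 1 (2 * n + 1) q =
    2 * (\<Sum>m. (-1) ^ m * of_nat (2 * m + 1) ^ (2 * n + 1) * q ^ (m * (m + 1) div 2))"
proof -
  let ?f = "\<lambda>m. theta_coeff 1 q m * of_int (2 * 1 * m + 1) ^ (2 * n + 1)"
  have "theta_moment 1 (2 * n + 1) q = 2 * (\<Sum>m. ?f (int m))"
    unfolding theta_moment_def
  proof (rule infsum_int_symmetric)
    show "(\<lambda>m. norm (?f m)) summable_on UNIV"
      by (rule theta_moment_summable) (use assms in auto)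
    fix m :: int
    have "(- 1) powi (- 1 - m) = - ((- 1) powi m :: complex)"
      by (cases "even m") auto
    moreover have "(- 1 - m) * (1 * (- 1 - m) + 1) div 2 = m * (1 * m + 1) div 2"
      by (simp add: algebra_simps)
    moreover have "of_int (2 * 1 * (- 1 - m) + 1) ^ (2 * n + 1) = - (of_int (2 * 1 * m + 1) ^ (2 * n + 1) :: complex)"
    proof -
      have "of_int (2 * 1 * (- 1 - m) + 1) = - (of_int (2 * 1 * m + 1) :: complex)"
        by simp
      moreover have "(- x) ^ (2 * n + 1) = - (x ^ (2 * n + 1))" for x :: complex
        by simp
      ultimately show ?thesis
        by (simp only:)
    qed
    ultimately show "?f (- 1 - m) = ?f m"
      unfolding theta_coeff_def by simp
  qed
  also have "(\<lambda>m. ?f (int m)) = (\<lambda>m. (-1) ^ m * of_nat (2 * m + 1) ^ (2 * n + 1) * q ^ (m * (m + 1) div 2))"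
  proof
    fix m
    have "int m * (1 * int m + 1) div 2 = int (m * (m + 1) div 2)"
      by (simp add: zdiv_int algebra_simps)
    moreover have "of_int (2 * 1 * int m + 1) = (of_nat (2 * m + 1) :: complex)"
      by simp
    ultimately show "?f (int m) = (-1) ^ m * of_nat (2 * m + 1) ^ (2 * n + 1) * q ^ (m * (m + 1) div 2)"
      by (simp only: theta_coeff_def power_int_of_nat mult_ac)
  qed
  finally show ?thesis .
qed

lemma U_conv_theta_moment:
  assumes "norm q < 1"
  shows "U n q = theta_moment 1 (2 * n + 1) q / theta_moment 1 1 q"
  using theta_moment_1_odd[OF assms, of n] theta_moment_1_odd[OF assms, of 0]
  by (simp add: U_def)

lemma V_conv_theta_moment: "V n q = theta_moment 3 (2 * n) q / theta_moment 3 0 q"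
  unfolding V_def theta_moment_def theta_coeff_def by (simp add: mult_ac)

lemma theta_moment_to_q_holomorphic:
  assumes "K \<ge> 1" "odd K"
  shows "(\<lambda>\<tau>. theta_moment K k (to_q \<tau>)) holomorphic_on upper_half_plane"
proof -
  have "to_q holomorphic_on upper_half_plane" "to_q ` upper_half_plane \<subseteq> ball 0 1"
    using norm_to_q_less_1 by (auto intro!: holomorphic_intros)
  then show ?thesis
    using holomorphic_on_compose_gen[OF _ theta_moment_holomorphic[OF assms], of to_q upper_half_plane k]
    by (simp add: o_def)
qed

lemma U_holomorphic: "(\<lambda>\<tau>. U n (to_q \<tau>)) holomorphic_on upper_half_plane"
proof (rule holomorphic_transform)
  show "(\<lambda>\<tau>. theta_moment 1 (2 * n + 1) (to_q \<tau>) / theta_moment 1 1 (to_q \<tau>)) holomorphic_on upper_half_plane"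
    by (intro holomorphic_on_divide theta_moment_to_q_holomorphic theta_moment_1_nonzero) auto
qed (simp add: U_conv_theta_moment norm_to_q_less_1)

lemma V_holomorphic: "(\<lambda>\<tau>. V n (to_q \<tau>)) holomorphic_on upper_half_plane"
  unfolding V_conv_theta_moment
  by (intro holomorphic_on_divide theta_moment_to_q_holomorphic theta_moment_3_nonzero) auto

lemma U_0: "\<tau> \<in> upper_half_plane \<Longrightarrow> U 0 (to_q \<tau>) = 1"
  using theta_moment_1_nonzero by (simp add: U_conv_theta_moment norm_to_q_less_1)

lemma V_0: "\<tau> \<in> upper_half_plane \<Longrightarrow> V 0 (to_q \<tau>) = 1"
  using theta_moment_3_nonzero by (simp add: V_conv_theta_moment)

lemma U_hat_0: "\<tau> \<in> upper_half_plane \<Longrightarrow> U_hat 0 \<tau> = 2 * of_real pi * \<i>"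
  by (simp add: U_hat_def U_0)

lemma V_hat_0: "\<tau> \<in> upper_half_plane \<Longrightarrow> V_hat 0 \<tau> = 1"
  by (simp add: V_hat_def V_0)

section \<open>The completed functions as Taylor coefficients\<close>

lemma U_hat_conv_coeff:
  assumes "\<tau> \<in> upper_half_plane"
  shows "fps_nth (gaussian_fps (of_nat 1 * of_real pi / 2 / of_real (Im \<tau>)) *
      Abs_fps (\<lambda>k. (of_real pi * \<i>) ^ k * theta_moment 1 k (to_q \<tau>) / fact k)) (2 * n + 1) =
    theta_moment 1 1 (to_q \<tau>) / 2 * U_hat n \<tau>"
proof -
  define q where "q = to_q \<tau>"
  have M: "theta_moment 1 (2 * k + 1) q = theta_moment 1 1 q * U k q" for k
    using theta_moment_1_nonzero[OF assms] U_conv_theta_moment[OF norm_to_q_less_1[OF assms], of k]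
    by (simp add: q_def)
  have "(of_nat 1 * of_real pi / 2 / of_real (Im \<tau>)) ^ j / fact j *
      ((of_real pi * \<i>) ^ (2 * n + 1 - 2 * j) * theta_moment 1 (2 * n + 1 - 2 * j) q / fact (2 * n + 1 - 2 * j)) =
      theta_moment 1 1 q / 2 * (2 * \<i> * ((-1) ^ (n + j) * (of_real pi ^ (2 * n - j + 1) * U (n - j) q) /
       ((2 * of_real (Im \<tau>)) ^ j * fact j * fact (2 * n - 2 * j + 1))))" if j: "j \<le> n" for j
  proof -
    \<comment> \<open>Writing n = j + k removes all truncated subtractions and turns (-1)^(n + j)
      into (-1)^k, the sign in (\<pi>i)^(2k + 1).\<close>
    obtain k where n: "n = j + k"
      using j le_Suc_ex by blast
    have eqs: "2 * n + 1 - 2 * j = 2 * k + 1" "2 * n - j + 1 = j + (2 * k + 1)" "n - j = k"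
        "2 * n - 2 * j + 1 = 2 * k + 1" "n + j = 2 * j + k"
      using n by auto
    have "(of_real pi * \<i>) ^ (2 * k + 1) = \<i> * ((- 1) ^ k * of_real pi ^ (2 * k + 1))"
      and "(- 1) ^ (2 * j + k) = ((- 1) ^ k :: complex)"
      by (simp_all add: power_mult power_mult_distrib power_add power_minus[of "(of_real pi)\<^sup>2"])
    then show ?thesis
      unfolding eqs M by (simp add: power_add power_mult_distrib power_divide field_simps)
  qed
  then show ?thesis
    unfolding gaussian_fps_mult_nth U_hat_def q_def[symmetric] sum_distrib_left
    by (intro sum.cong) auto
qed

text \<open>Only even coefficients occur, where the symmetrising factor 1 + (-1)^k equals 2.\<close>

lemma V_hat_conv_coeff:
  assumes "\<tau> \<in> upper_half_plane"
  shows "fps_nth (gaussian_fps (of_nat 3 * of_real pi / 2 / of_real (Im \<tau>)) *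
      Abs_fps (\<lambda>k. (1 + (- 1) ^ k) * ((of_real pi * \<i>) ^ k * theta_moment 3 k (to_q \<tau>) / fact k))) (2 * n) =
    2 * theta_moment 3 0 (to_q \<tau>) * V_hat n \<tau>"
proof -
  define q where "q = to_q \<tau>"
  have M: "theta_moment 3 (2 * k) q = theta_moment 3 0 q * V k q" for k
    using theta_moment_3_nonzero[OF assms] V_conv_theta_moment[of k q]
    by (simp add: q_def)
  have "(of_nat 3 * of_real pi / 2 / of_real (Im \<tau>)) ^ j / fact j *
      ((1 + (- 1) ^ (2 * n - 2 * j)) * ((of_real pi * \<i>) ^ (2 * n - 2 * j) * theta_moment 3 (2 * n - 2 * j) q / fact (2 * n - 2 * j))) =
      2 * theta_moment 3 0 q * ((-1) ^ (n + j) * (3 ^ j * of_real pi ^ (2 * n - j) * V (n - j) q) /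
       ((2 * of_real (Im \<tau>)) ^ j * fact j * fact (2 * n - 2 * j)))" if j: "j \<le> n" for j
  proof -
    obtain k where n: "n = j + k"
      using j le_Suc_ex by blast
    have eqs: "2 * n - 2 * j = 2 * k" "2 * n - j = j + 2 * k" "n - j = k" "n + j = 2 * j + k"
      using n by auto
    have "(of_real pi * \<i>) ^ (2 * k) = (- 1) ^ k * of_real pi ^ (2 * k)"
      and "(- 1) ^ (2 * j + k) = ((- 1) ^ k :: complex)"
      by (simp_all add: power_mult power_mult_distrib power_add power_minus[of "(of_real pi)\<^sup>2"])
    then show ?thesis
      unfolding eqs M by (simp add: power_add power_mult_distrib power_divide field_simps)
  qed
  then show ?thesis
    unfolding gaussian_fps_mult_nth V_hat_def q_def[symmetric] sum_distrib_left
    by (intro sum.cong) auto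
qed

section \<open>Modularity of the completed functions\<close>

lemma theta_even_has_fps_expansion:
  assumes "\<tau> \<in> upper_half_plane"
  shows "theta_even \<tau> has_fps_expansion
    Abs_fps (\<lambda>k. (1 + (- 1) ^ k) * ((of_real pi * \<i>) ^ k * theta_moment 3 k (to_q \<tau>) / fact k))"
proof -
  have 3: "theta 3 \<tau> has_fps_expansion Abs_fps (\<lambda>k. (of_real pi * \<i>) ^ k * theta_moment 3 k (to_q \<tau>) / fact k)"
    by (intro theta_has_fps_expansion assms) auto
  from has_fps_expansion_add[OF 3 has_fps_expansion_scale[OF 3, of "- 1"]] show ?thesis
    unfolding theta_even_def[abs_def]
    by (simp add: ring_distribs add_divide_distrib fps_plus_def)
qed

text \<open>The coefficient of z^(2n + 1) transforms with \<kappa> and J^(-2n - 1). Comparison with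
  the case n = 0 eliminates \<kappa> and one factor J, which leaves weight 2n.\<close>

lemma U_hat_moebius:
  assumes det: "a * d - b * c = 1" and \<tau>: "\<tau> \<in> upper_half_plane"
  shows "U_hat n (moebius_action a b c d \<tau>) = (of_int c * \<tau> + of_int d) powi (2 * int n) * U_hat n \<tau>"
proof -
  define J where "J = of_int c * \<tau> + of_int d"
  define \<tau>' where "\<tau>' = moebius_action a b c d \<tau>"
  have J: "J \<noteq> 0"
    unfolding J_def by (rule automorphy_nonzero[OF det \<tau>])
  have \<tau>': "\<tau>' \<in> upper_half_plane"
    unfolding \<tau>'_def by (rule moebius_in_upper_half_plane[OF det \<tau>])
  obtain \<kappa> where \<kappa>: "\<And>z. theta 1 \<tau>' (z / J) = \<kappa> * epi (of_nat 1 * of_int c * z ^ 2 / J) * theta 1 \<tau> z"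
    using theta_1_moebius[OF det \<tau>] unfolding J_def \<tau>'_def by auto
  let ?M = "theta_moment 1 1 (to_q \<tau>)" and ?M' = "theta_moment 1 1 (to_q \<tau>')"
  have eq: "(1 / J) ^ (2 * n + 1) * (?M' / 2 * U_hat n \<tau>') = \<kappa> * (?M / 2 * U_hat n \<tau>)" for n
    using gaussian_twist_coeff_moebius[OF det \<tau>
        theta_has_fps_expansion[OF order.refl odd_1_3(1) \<tau>'] theta_has_fps_expansion[OF order.refl odd_1_3(1) \<tau>]
        \<kappa>[unfolded J_def], of "2 * n + 1"]
    unfolding J_def[symmetric] \<tau>'_def[symmetric] U_hat_conv_coeff[OF \<tau>] U_hat_conv_coeff[OF \<tau>'] .
  \<comment> \<open>Since \<open>U_hat 0\<close> is the constant 2\<pi>i at both points, the case n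
    = 0 determines \<kappa>.\<close>
  have "(of_real pi * \<i>) * (1 / J * ?M' - \<kappa> * ?M) = 0"
    using eq[of 0] by (simp add: U_hat_0 \<tau> \<tau>' algebra_simps)
  then have M': "1 / J * ?M' = \<kappa> * ?M"
    by simp
  have "(1 / J) ^ (2 * n) * U_hat n \<tau>' * (1 / J * ?M') = 2 * ((1 / J) ^ (2 * n + 1) * (?M' / 2 * U_hat n \<tau>'))"
    by simp
  also have "\<dots> = U_hat n \<tau> * (1 / J * ?M')"
    unfolding eq M' by simp
  finally have "(1 / J) ^ (2 * n) * U_hat n \<tau>' = U_hat n \<tau>"
    using J theta_moment_1_nonzero[OF \<tau>'] by simp
  moreover have "J powi (2 * int n) = J ^ (2 * n)"
    by (metis of_nat_mult of_nat_numeral power_int_of_nat)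
  ultimately show ?thesis
    using J unfolding J_def[symmetric] \<tau>'_def[symmetric] by (simp add: field_simps)
qed

lemma V_hat_moebius:
  assumes det: "a * d - b * c = 1" and \<tau>: "\<tau> \<in> upper_half_plane"
  shows "V_hat n (moebius_action a b c d \<tau>) = (of_int c * \<tau> + of_int d) powi (2 * int n) * V_hat n \<tau>"
proof -
  define J where "J = of_int c * \<tau> + of_int d"
  define \<tau>' where "\<tau>' = moebius_action a b c d \<tau>"
  have J: "J \<noteq> 0"
    unfolding J_def by (rule automorphy_nonzero[OF det \<tau>])
  have \<tau>': "\<tau>' \<in> upper_half_plane"
    unfolding \<tau>'_def by (rule moebius_in_upper_half_plane[OF det \<tau>])
  obtain \<kappa> where \<kappa>: "\<And>z. theta_even \<tau>' (z / J) = \<kappa> * epi (of_nat 3 * of_int c * z ^ 2 / J) * theta_even \<tau> z"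
    using theta_even_moebius[OF det \<tau>] unfolding J_def \<tau>'_def by auto
  let ?M = "theta_moment 3 0 (to_q \<tau>)" and ?M' = "theta_moment 3 0 (to_q \<tau>')"
  have eq: "(1 / J) ^ (2 * n) * (2 * ?M' * V_hat n \<tau>') = \<kappa> * (2 * ?M * V_hat n \<tau>)" for n
    using gaussian_twist_coeff_moebius[OF det \<tau>
        theta_even_has_fps_expansion[OF \<tau>'] theta_even_has_fps_expansion[OF \<tau>] \<kappa>[unfolded J_def], of "2 * n"]
    unfolding J_def[symmetric] \<tau>'_def[symmetric] V_hat_conv_coeff[OF \<tau>] V_hat_conv_coeff[OF \<tau>'] .
  have M': "?M' = \<kappa> * ?M"
    using eq[of 0] by (simp add: V_hat_0 \<tau> \<tau>')
  have "(1 / J) ^ (2 * n) * V_hat n \<tau>' * ?M' = (1 / J) ^ (2 * n) * (2 * ?M' * V_hat n \<tau>') / 2"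
    by simp
  also have "\<dots> = V_hat n \<tau> * ?M'"
    unfolding eq by (simp add: M')
  finally have "(1 / J) ^ (2 * n) * V_hat n \<tau>' = V_hat n \<tau>"
    using theta_moment_3_nonzero[OF \<tau>'] by simp
  moreover have "J powi (2 * int n) = J ^ (2 * n)"
    by (metis of_nat_mult of_nat_numeral power_int_of_nat)
  ultimately show ?thesis
    using J unfolding J_def[symmetric] \<tau>'_def[symmetric] by (simp add: field_simps)
qed

section \<open>Coefficients of the expansions and the lowering operator\<close>

definition U_hat_coeff :: "nat \<Rightarrow> nat \<Rightarrow> complex \<Rightarrow> complex" where
  "U_hat_coeff n j \<tau> = 2 * \<i> * ((-1) ^ (n + j) * (of_real pi ^ (2 * n - j + 1) * U (n - j) (to_q \<tau>)) /
     (2 ^ j * fact j * fact (2 * n - 2 * j + 1)))"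

definition V_hat_coeff :: "nat \<Rightarrow> nat \<Rightarrow> complex \<Rightarrow> complex" where
  "V_hat_coeff n j \<tau> = (-1) ^ (n + j) * (3 ^ j * of_real pi ^ (2 * n - j) * V (n - j) (to_q \<tau>)) /
     (2 ^ j * fact j * fact (2 * n - 2 * j))"

lemma U_hat_expansion: "almost_holomorphic_expansion (U_hat n) n (U_hat_coeff n)"
  unfolding almost_holomorphic_expansion_def
proof (intro conjI allI impI ballI)
  show "U_hat_coeff n j holomorphic_on upper_half_plane" for j
    unfolding U_hat_coeff_def[abs_def] by (intro holomorphic_intros U_holomorphic) auto
  show "U_hat n \<tau> = (\<Sum>j\<le>n. U_hat_coeff n j \<tau> * (1 / of_real (Im \<tau>)) ^ j)" for \<tau>
    unfolding U_hat_def U_hat_coeff_def sum_distrib_left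
    by (intro sum.cong) (auto simp: power_mult_distrib power_divide)
qed

lemma V_hat_expansion: "almost_holomorphic_expansion (V_hat n) n (V_hat_coeff n)"
  unfolding almost_holomorphic_expansion_def
proof (intro conjI allI impI ballI)
  show "V_hat_coeff n j holomorphic_on upper_half_plane" for j
    unfolding V_hat_coeff_def[abs_def] by (intro holomorphic_intros V_holomorphic) auto
  show "V_hat n \<tau> = (\<Sum>j\<le>n. V_hat_coeff n j \<tau> * (1 / of_real (Im \<tau>)) ^ j)" for \<tau>
    unfolding V_hat_def V_hat_coeff_def
    by (intro sum.cong) (auto simp: power_mult_distrib power_divide)
qed

lemma lowering_op_recurrence:
  assumes f: "almost_holomorphic_expansion f (Suc n) g" and f': "almost_holomorphic_expansion f' n g'"
    and \<tau>: "\<tau> \<in> upper_half_plane" and rec: "\<And>j. j \<le> n \<Longrightarrow> of_nat (Suc j) * g (Suc j) \<tau> = c * g' j \<tau>"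
  shows "lowering_op f \<tau> = - c * f' \<tau>"
proof -
  have "(\<Sum>j\<le>Suc n. of_nat j * g j \<tau> * (1 / of_real (Im \<tau>)) ^ (j - 1)) =
      (\<Sum>j\<le>n. of_nat (Suc j) * g (Suc j) \<tau> * (1 / of_real (Im \<tau>)) ^ j)"
    by (subst sum.atMost_Suc_shift) simp
  also have "\<dots> = c * f' \<tau>"
    using f' \<tau> rec by (simp add: almost_holomorphic_expansion_def sum_distrib_left mult.assoc del: of_nat_Suc)
  finally show ?thesis
    by (simp add: lowering_op_expansion[OF f \<tau>])
qed

text \<open>Raising n and j together by 1 keeps n - j, hence also \<open>U (n - j)\<close> and the
  sign. It adds one factor \<pi> in the numerator and 2(j + 1) in the denominator, and the lowering
  operator supplies the j + 1.\<close>

lemma lowering_op_U_hat: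
  assumes "\<tau> \<in> upper_half_plane"
  shows "lowering_op (U_hat (Suc n)) \<tau> = - (of_real pi / 2) * U_hat n \<tau>"
proof (rule lowering_op_recurrence[OF U_hat_expansion U_hat_expansion assms])
  fix j assume "j \<le> n"
  then obtain k where n: "n = j + k"
    using le_Suc_ex by blast
  show "of_nat (Suc j) * U_hat_coeff (Suc n) (Suc j) \<tau> = of_real pi / 2 * U_hat_coeff n j \<tau>"
    unfolding U_hat_coeff_def n by (simp add: field_simps del: of_nat_Suc)
qed

lemma lowering_op_V_hat:
  assumes "\<tau> \<in> upper_half_plane"
  shows "lowering_op (V_hat (Suc n)) \<tau> = - (3 * of_real pi / 2) * V_hat n \<tau>"
proof (rule lowering_op_recurrence[OF V_hat_expansion V_hat_expansion assms])
  fix j assume "j \<le> n"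
  then obtain k where n: "n = j + k"
    using le_Suc_ex by blast
  show "of_nat (Suc j) * V_hat_coeff (Suc n) (Suc j) \<tau> = 3 * of_real pi / 2 * V_hat_coeff n j \<tau>"
    unfolding V_hat_coeff_def n by (simp add: field_simps del: of_nat_Suc)
qed

theorem theorem1p4:
  fixes n :: nat
  shows
    "(almost_holomorphic_modular_form (2 * int n) (U_hat n) \<and> depth (U_hat n) = n \<and>
      almost_holomorphic_modular_form (2 * int n) (V_hat n) \<and> depth (V_hat n) = n) \<and>
     ((\<forall>\<tau>\<in>upper_half_plane. U_hat 0 \<tau> = 2 * of_real pi * \<i> \<and> V_hat 0 \<tau> = 1) \<and>
      (n \<ge> 1 \<longrightarrow> (\<forall>\<tau>\<in>upper_half_plane.
         lowering_op (U_hat n) \<tau> = - (of_real pi / 2) * U_hat (n - 1) \<tau> \<and>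
         lowering_op (V_hat n) \<tau> = - (3 * of_real pi / 2) * V_hat (n - 1) \<tau>))) \<and>
     (\<forall>\<tau>\<in>upper_half_plane.
        conj_limit (U_hat n) \<tau> =
          2 * (of_real pi * \<i>) ^ (2 * n + 1) * U n (to_q \<tau>) / fact (2 * n + 1) \<and>
        conj_limit (V_hat n) \<tau> =
          (of_real pi * \<i>) ^ (2 * n) / fact (2 * n) * V n (to_q \<tau>))"
proof (intro conjI ballI impI)
  show "almost_holomorphic_modular_form (2 * int n) (U_hat n)"
    unfolding almost_holomorphic_modular_form_def moebius_action_def[symmetric]
    using U_hat_moebius U_hat_expansion by blast
  show "almost_holomorphic_modular_form (2 * int n) (V_hat n)"
    unfolding almost_holomorphic_modular_form_def moebius_action_def[symmetric]
    using V_hat_moebius V_hat_expansion by blast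
  \<comment> \<open>Any point would do as a witness: \<open>U 0\<close> and \<open>V 0\<close> are 1
    on the half-plane, so the coefficients of v^(-n) are nonzero constants.\<close>
  have \<i>: "\<i> \<in> upper_half_plane"
    by (simp add: upper_half_plane_def)
  show "depth (U_hat n) = n"
    by (rule depth_eqI[OF U_hat_expansion \<i>]) (simp add: U_hat_coeff_def U_0 \<i>)
  show "depth (V_hat n) = n"
    by (rule depth_eqI[OF V_hat_expansion \<i>]) (simp add: V_hat_coeff_def V_0 \<i>)
next
  fix \<tau> assume \<tau>: "\<tau> \<in> upper_half_plane"
  show "U_hat 0 \<tau> = 2 * of_real pi * \<i>" "V_hat 0 \<tau> = 1"
    using \<tau> by (simp_all add: U_hat_0 V_hat_0)
  show "conj_limit (U_hat n) \<tau> = 2 * (of_real pi * \<i>) ^ (2 * n + 1) * U n (to_q \<tau>) / fact (2 * n + 1)"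
    by (simp add: conj_limit_eqI[OF U_hat_expansion \<tau>] U_hat_coeff_def power_mult_distrib power_mult
        power_minus[of "(of_real pi)\<^sup>2"])
  show "conj_limit (V_hat n) \<tau> = (of_real pi * \<i>) ^ (2 * n) / fact (2 * n) * V n (to_q \<tau>)"
    by (simp add: conj_limit_eqI[OF V_hat_expansion \<tau>] V_hat_coeff_def power_mult_distrib power_mult
        power_minus[of "(of_real pi)\<^sup>2"])
next
  fix \<tau> assume \<tau>: "\<tau> \<in> upper_half_plane" and "n \<ge> 1"
  then obtain k where "n = Suc k"
    by (cases n) auto
  with \<tau> show "lowering_op (U_hat n) \<tau> = - (of_real pi / 2) * U_hat (n - 1) \<tau>"
    "lowering_op (V_hat n) \<tau> = - (3 * of_real pi / 2) * V_hat (n - 1) \<tau>"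
    by (simp_all add: lowering_op_U_hat lowering_op_V_hat)
qed

end
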